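(* Let $m\ge2$ and let $\tau_1$ be the function defined in the context. Then: (1) For fixed $n_2,\ldots,n_m\in\mathbb{N}_{\ge1}$, $$\lim_{n_1\to\infty}\tau_1(n_1,\ldots,n_m)=\prod_{k=2}^m\mathbb{P}(G_k\le n_k),$$ where $G_k\sim\operatorname{Gamma}(n_k,1)$, $k=2,\ldots,m$. (2) For fixed $n_1,\ldots,n_{m-1}\in\mathbb{N}_{\ge1}$, with $(X_2,\ldots,X_m)\sim\operatorname{ID}(n_2,\ldots,n_m;n_1)$, $$\lim_{n_m\to\infty}\tau_1(n_1,\ldots,n_m)=\int_0^{\frac{n_2}{n_1}}\cdots\int_0^{\frac{n_{m-1}}{n_1}}\int_{n_1\left(1+\sum_{k=2}^{m-1}s_k\right)}^\infty f_\Gamma(s_m)\,ds_m\ \varphi_{<m}(s_2,\ldots,s_{m-1})\,ds_{m-1}\cdots ds_2,$$ where $\varphi_{<m}$ is the marginal density of $(X_2,\ldots,X_{m-1})$ and $f_\Gamma$ is the density of the $\operatorname{Gamma}\big(\sum_{k=1}^{m-1}n_k,1\big)$ distribution. (For $m=2$ the outer integrals and the factor $\varphi_{<m}$ are absent.) (3) For given real $\alpha_1,\ldots,\alpha_m>0$, $$\lim_{n\to\infty}\tau_1(\alpha_1n,\ldots,\alpha_mn)=\int_{-\infty}^\infty\prod_{k=2}^m\Phi\Big(\sqrt{\tfrac{\alpha_k}{\alpha_1}}\,z\Big)\frac{1}{\sqrt{2\pi}}e^{-\frac{z^2}{2}}\,dz,$$ where $n$ runs through $\mathbb{N}_{\g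e1}$.
   Context: For $n_1,\ldots,n_m\in\mathbb{N}_{\ge1}$, $$\tau_1(n_1,\ldots,n_m)=\mathbb{P}(A_2\ge n_2,\ldots,A_m\ge n_m),$$ where $(A_2,\ldots,A_m)$ has a negative multinomial distribution with parameters $(n_1;p_2,\ldots,p_m)$, $p_\ell=\frac{n_\ell}{n_1+\cdots+n_m}$; that is, with $p_1:=1-\sum_{k=2}^m p_k$, for all integers $k_2,\ldots,k_m\ge0$, $$\mathbb{P}(A_2=k_2,\ldots,A_m=k_m)=\frac{(n_1+k_2+\cdots+k_m-1)!}{(n_1-1)!\,k_2!\cdots k_m!}\,p_1^{n_1}\prod_{\ell=2}^m p_\ell^{k_\ell}.$$ In part (3), $\tau_1$ is extended to positive real arguments by $$\tau_1(x_1,\ldots,x_m)=\mathbb{P}\left(\frac{G_2}{x_2}\le\frac{G_1}{x_1},\ldots,\frac{G_m}{x_m}\le\frac{G_1}{x_1}\right)$$ with independent $G_j\sim\operatorname{Gamma}(x_j,1)$ (this agrees with $\tau_1$ for positive integers). $\operatorname{Gamma}(a,1)$ has density $x^{a-1}e^{-x}/\Gamma(a)$ on $(0,\infty)$. $\Phi$ is the standard normal cumulative distribution function. $\operatorname{ID}(n_2,\ldots,n_m;n_1)$ is the inverted Dirichlet distribution on $[0,\infty)^{m-1}$ with density $$(s_2,\ldots,s_m)\mapsto\frac{\Gamma\big(\sum_{k=1}^m n_k\big)}{\prod_{k=1}^m\Gamma(n_k)}\cdot\frac{\prod_{k=2}^m s_k^{n_k-1}}{\big(1+\sum_{k=2}^m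 s_k\big)^{\sum_{k=1}^m n_k}};$$ its marginal $(X_2,\ldots,X_{m-1})$ has distribution $\operatorname{ID}(n_2,\ldots,n_{m-1};n_1)$, so $\varphi_{<m}$ does not depend on $n_m$. *)

theory Defs
  imports "HOL-Probability.Probability"
begin

text \<open>
  Random vectors \<open>(Y\<^sub>l)\<close> with \<open>l \<in> I\<close> are represented by their law on the extensional
  functions on the index set \<open>I\<close>. Parameters \<open>n 1, \<dots>, n m\<close> are the values on \<open>{1..m}\<close> of a
  function on \<open>nat\<close>; other values are irrelevant.
\<close>

definition neg_multinomial_mass ::
    "nat \<Rightarrow> nat set \<Rightarrow> (nat \<Rightarrow> real) \<Rightarrow> (nat \<Rightarrow> nat) \<Rightarrow> real" where
  "neg_multinomial_mass r I p k =
     fact (r + (\<Sum>l\<in>I. k l) - 1) / (fact (r - 1) * (\<Prod>l\<in>I. fact (k l)))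
       * (1 - (\<Sum>l\<in>I. p l)) ^ r * (\<Prod>l\<in>I. p l ^ k l)"

definition neg_multinomial :: "nat \<Rightarrow> nat set \<Rightarrow> (nat \<Rightarrow> real) \<Rightarrow> (nat \<Rightarrow> nat) measure" where
  "neg_multinomial r I p =
     density (count_space (I \<rightarrow>\<^sub>E UNIV)) (\<lambda>k. ennreal (neg_multinomial_mass r I p k))"

definition tau1 :: "nat \<Rightarrow> (nat \<Rightarrow> nat) \<Rightarrow> real" where
  "tau1 m n =
     measure (neg_multinomial (n 1) {2..m} (\<lambda>l. real (n l) / real (\<Sum>j=1..m. n j)))
       {k \<in> {2..m} \<rightarrow>\<^sub>E UNIV. \<forall>l\<in>{2..m}. n l \<le> k l}"

definition gamma_density :: "real \<Rightarrow> real \<Rightarrow> real" where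
  "gamma_density a x = (if 0 < x then x powr (a - 1) * exp (- x) / Gamma a else 0)"

definition gamma_distribution :: "real \<Rightarrow> real measure" where
  "gamma_distribution a = density lborel (\<lambda>x. ennreal (gamma_density a x))"

text \<open>The extension of \<open>\<tau>\<^sub>1\<close> to positive real arguments; independence of the gamma variables is
  expressed by the product measure.\<close>

definition tau1_real :: "nat \<Rightarrow> (nat \<Rightarrow> real) \<Rightarrow> real" where
  "tau1_real m x =
     (let P = Pi\<^sub>M {1..m} (\<lambda>j. gamma_distribution (x j))
      in measure P {g \<in> space P. \<forall>l\<in>{2..m}. g l / x l \<le> g 1 / x 1})"

definition inverted_dirichlet_density ::
    "nat set \<Rightarrow> (nat \<Rightarrow> nat) \<Rightarrow> nat \<Rightarrow> (nat \<Rightarrow> real) \<Rightarrow> real" where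
  "inverted_dirichlet_density I n r s =
     (if \<forall>k\<in>I. 0 \<le> s k
      then Gamma (real (r + (\<Sum>k\<in>I. n k))) / (Gamma (real r) * (\<Prod>k\<in>I. Gamma (real (n k))))
           * ((\<Prod>k\<in>I. s k ^ (n k - 1)) / (1 + (\<Sum>k\<in>I. s k)) ^ (r + (\<Sum>k\<in>I. n k)))
      else 0)"

text \<open>The density of \<open>(X\<^sub>2, \<dots>, X\<^bsub>m-1\<^esub>)\<close> for \<open>(X\<^sub>2, \<dots>, X\<^sub>m) \<sim> ID(n\<^sub>2, \<dots>, n\<^sub>m; n\<^sub>1)\<close>, obtained by
  integrating out the last coordinate. For \<open>m = 2\<close> this is the total mass of the density,
  a constant function on the one-point space of functions on the empty index set.\<close>

definition inverted_dirichlet_marginal_density ::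
    "nat \<Rightarrow> (nat \<Rightarrow> nat) \<Rightarrow> (nat \<Rightarrow> real) \<Rightarrow> real" where
  "inverted_dirichlet_marginal_density m n s =
     (LBINT t. inverted_dirichlet_density {2..m} n (n 1) (s(m := t)))"

end

theory Submission
  imports Defs "HOL-Real_Asymp.Real_Asymp"
begin

text \<open>
  Conditionally on a gamma variable \<open>g\<close> with shape \<open>n 1\<close>, a negative multinomial vector has
  independent Poisson coordinates with rates \<open>n l / n 1 * g\<close>, and a Poisson tail is a gamma
  distribution function. Hence \<open>\<tau>\<^sub>1\<close>, for integer as well as for real parameters, is the mean of
  \<open>\<Prod>l. F\<^sub>l (n l / n 1 * g)\<close>, where \<open>F\<^sub>l\<close> is the distribution function of \<open>Gamma(n l, 1)\<close>.
  All limits then follow from one statement: after centring at the mode and rescaling, the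
  gamma densities are, up to normalisation, dominated by a fixed integrable function and converge
  to \<open>exp (- z\<^sup>2 / 2)\<close>. Integrating the kernels themselves yields the normalisation, so Stirling's
  formula is not needed. In the second limit the factor \<open>F\<^sub>m\<close> becomes the indicator of \<open>g > n 1\<close>;
  substituting \<open>s l = G l / g\<close> then produces the inverted Dirichlet density.
\<close>

section \<open>Gamma distributions with large shape parameter\<close>

lemma gamma_density_nonneg: "0 \<le> a \<Longrightarrow> 0 \<le> gamma_density a x"
  \<comment> \<open>At the pole \<open>a = 0\<close> both \<open>Gamma 0\<close> and division by it
    take the default value 0, so the density vanishes there.\<close>
  by (cases "a = 0") (auto simp: gamma_density_def intro!: divide_nonneg_nonneg less_imp_le[OF Gamma_real_pos])

lemma borel_measurable_gamma_density [measurable]: "gamma_density a \<in> borel_measurable borel"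
  unfolding gamma_density_def[abs_def] by measurable

lemma space_gamma_distribution [simp]: "space (gamma_distribution a) = UNIV"
  by (simp add: gamma_distribution_def)

lemma sets_gamma_distribution [simp, measurable_cong]: "sets (gamma_distribution a) = sets borel"
  by (simp add: gamma_distribution_def)

lemma prob_space_gamma_distribution:
  assumes "0 < a"
  shows "prob_space (gamma_distribution a)"
proof
  have "emeasure (gamma_distribution a) (space (gamma_distribution a))
      = (\<integral>\<^sup>+x. ennreal (gamma_density a x) \<partial>lborel)"
    by (simp add: gamma_distribution_def emeasure_density)
  also have "\<dots> = (\<integral>\<^sup>+x. ennreal (indicator {0..} x * x powr (a - 1) / exp x) * ennreal (1 / Gamma a) \<partial>lborel)"
    using assms
    by (intro nn_integral_cong)
       (auto simp: gamma_density_def ennreal_mult''[symmetric] exp_minus field_simps split: split_indicator)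
  also have "\<dots> = ennreal (Gamma a) * ennreal (1 / Gamma a)"
    by (subst nn_integral_multc) (auto simp: Gamma_conv_nn_integral_real[OF assms])
  also have "\<dots> = 1"
    using Gamma_real_pos[OF assms] by (simp add: ennreal_mult''[symmetric])
  finally show "emeasure (gamma_distribution a) (space (gamma_distribution a)) = 1" .
qed

lemma integral_gamma_distribution:
  fixes u :: "real \<Rightarrow> real"
  assumes "0 < a" and [measurable]: "u \<in> borel_measurable borel"
  shows "integral\<^sup>L (gamma_distribution a) u = (LBINT x. gamma_density a x * u x)"
  unfolding gamma_distribution_def
  using gamma_density_nonneg[of a] assms by (subst integral_density) auto

text \<open>Taylor's quadratic lower bound for \<open>u - ln (1 + u)\<close> fails for large
  positive \<open>u\<close>, where the growth is only linear; the factor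
  \<open>1 + \<bar>u\<bar>\<close> in the denominator corrects this. On each side of 0 the
  difference vanishes at 0 and has a derivative of constant sign. The estimate controls the exponent
  of \<open>gamma_kernel\<close>.\<close>

lemma ln_add_one_upper_bound_quadratic:
  fixes u :: real
  assumes "-1 < u"
  shows "u\<^sup>2 / (2 * (1 + \<bar>u\<bar>)) \<le> u - ln (1 + u)"
proof (cases "0 \<le> u")
  case True
  define f where "f = (\<lambda>u::real. u - ln (1 + u) - u\<^sup>2 / (2 * (1 + u)))"
  have "f 0 \<le> f u"
  proof (rule DERIV_nonneg_imp_nondecreasing[OF True])
    fix t :: real assume t: "0 \<le> t" "t \<le> u"
    have "DERIV f t :> 1 - 1 / (1 + t) - (2 * t * (2 * (1 + t)) - t\<^sup>2 * 2) / (2 * (1 + t))\<^sup>2"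
      unfolding f_def using t by (auto intro!: derivative_eq_intros simp: power2_eq_square)
    moreover have "1 - 1 / (1 + t) - (2 * t * (2 * (1 + t)) - t\<^sup>2 * 2) / (2 * (1 + t))\<^sup>2
       = t\<^sup>2 / (2 * (1 + t)\<^sup>2)"
    proof -
      define s where "s = 1 + t"
      have "0 < s" "t = s - 1" using t by (auto simp: s_def)
      then show ?thesis
        by (simp add: power2_eq_square divide_simps)
    qed
    ultimately show "\<exists>y. DERIV f t :> y \<and> 0 \<le> y"
      by (metis divide_nonneg_nonneg mult_nonneg_nonneg zero_le_numeral zero_le_power2)
  qed
  then show ?thesis using True by (simp add: f_def)
next
  case False
  \<comment> \<open>For negative \<open>u\<close> the stronger bound without the factor
    \<open>1 + \<bar>u\<bar>\<close> holds.\<close>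
  define f where "f = (\<lambda>u::real. u - ln (1 + u) - u\<^sup>2 / 2)"
  have "f 0 \<le> f u"
  proof (rule DERIV_nonpos_imp_nonincreasing[where f = f])
    show "u \<le> 0" using False by simp
    fix t :: real assume t: "u \<le> t" "t \<le> 0"
    have "DERIV f t :> 1 - 1 / (1 + t) - t"
      unfolding f_def using t assms by (auto intro!: derivative_eq_intros)
    moreover have "1 - 1 / (1 + t) - t = - (t\<^sup>2 / (1 + t))"
      using t assms by (simp add: field_simps power2_eq_square)
    moreover have "- (t\<^sup>2 / (1 + t)) \<le> 0"
      using t assms by simp
    ultimately show "\<exists>y. DERIV f t :> y \<and> y \<le> 0" by metis
  qed
  then have "u\<^sup>2 / 2 \<le> u - ln (1 + u)" by (simp add: f_def)
  moreover have "u\<^sup>2 / (2 * (1 + \<bar>u\<bar>)) \<le> u\<^sup>2 / 2"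
    by (intro divide_left_mono) auto
  ultimately show ?thesis by (rule order_trans[rotated])
qed

text \<open>The density of Gamma(y + 1, 1) at \<open>y + sqrt y * z\<close>, divided by its value at
  the mode \<open>y\<close>. The condition \<open>0 < 1 + z / sqrt y\<close> says that this point is
  positive.\<close>

definition gamma_kernel :: "real \<Rightarrow> real \<Rightarrow> real" where
  "gamma_kernel y z =
     (if 0 < 1 + z / sqrt y then exp (y * (ln (1 + z / sqrt y) - z / sqrt y)) else 0)"

lemma borel_measurable_gamma_kernel [measurable]: "gamma_kernel y \<in> borel_measurable borel"
  unfolding gamma_kernel_def[abs_def] by measurable

lemma gamma_kernel_nonneg: "0 \<le> gamma_kernel y z"
  by (simp add: gamma_kernel_def)

text \<open>For \<open>u = z / sqrt y\<close> with \<open>1 \<le> y\<close> one has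
  \<open>\<bar>u\<bar> \<le> \<bar>z\<bar>\<close>, so replacing \<open>1 + \<bar>u\<bar>\<close> by
  \<open>1 + \<bar>z\<bar>\<close> makes the quadratic estimate uniform in \<open>y\<close>. The
  result is an integrable majorant with exponential tails.\<close>

lemma gamma_kernel_bound:
  assumes "1 \<le> y"
  shows "gamma_kernel y z \<le> exp ((1 - \<bar>z\<bar>) / 2)"
proof (cases "0 < 1 + z / sqrt y")
  case True
  define u where "u = z / sqrt y"
  have y: "0 < y" "1 \<le> sqrt y" using assms by auto
  have z: "z\<^sup>2 = y * u\<^sup>2" using y by (simp add: u_def power_divide)
  have "\<bar>u\<bar> \<le> \<bar>z\<bar>"
    using y by (simp add: u_def abs_divide divide_le_eq mult_le_cancel_left1)
  \<comment> \<open>This is \<open>(\<bar>z\<bar> - 1) * (\<bar>z\<bar> + 1) = z\<^sup>2 - 1 \<le>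
    z\<^sup>2\<close>.\<close>
  have "(\<bar>z\<bar> - 1) / 2 \<le> z\<^sup>2 / (2 * (1 + \<bar>z\<bar>))"
    by (simp add: field_simps power2_eq_square abs_mult_self)
  also have "\<dots> \<le> z\<^sup>2 / (2 * (1 + \<bar>u\<bar>))"
    using \<open>\<bar>u\<bar> \<le> \<bar>z\<bar>\<close> by (intro divide_left_mono mult_pos_pos) auto
  also have "\<dots> = y * (u\<^sup>2 / (2 * (1 + \<bar>u\<bar>)))" by (simp add: z)
  also have "\<dots> \<le> y * (u - ln (1 + u))"
    using True y by (intro mult_left_mono ln_add_one_upper_bound_quadratic) (auto simp: u_def)
  finally have "(\<bar>z\<bar> - 1) / 2 \<le> y * (u - ln (1 + u))" .
  then have "- (y * (u - ln (1 + u))) \<le> - ((\<bar>z\<bar> - 1) / 2)" by (rule le_imp_neg_le)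
  then have "y * (ln (1 + u) - u) \<le> (1 - \<bar>z\<bar>) / 2"
    by (metis minus_diff_eq minus_divide_left minus_mult_right)
  then show ?thesis using True by (simp add: gamma_kernel_def u_def)
qed (simp add: gamma_kernel_def)

lemma gamma_kernel_tendsto: "((\<lambda>y. gamma_kernel y z) \<longlongrightarrow> exp (- (z\<^sup>2 / 2))) at_top"
proof -
  have "((\<lambda>y. y * (ln (1 + z / sqrt y) - z / sqrt y)) \<longlongrightarrow> - (z\<^sup>2 / 2)) at_top"
    by (cases z "0::real" rule: linorder_cases; real_asymp simp: power2_eq_square)
  then have "((\<lambda>y. exp (y * (ln (1 + z / sqrt y) - z / sqrt y))) \<longlongrightarrow> exp (- (z\<^sup>2 / 2))) at_top"
    by (rule tendsto_exp)
  moreover have "((\<lambda>y. 1 + z / sqrt y) \<longlongrightarrow> 1) at_top"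
    by real_asymp
  then have "\<forall>\<^sub>F y in at_top. 0 < 1 + z / sqrt y"
    by (rule order_tendstoD) simp
  then have "\<forall>\<^sub>F y in at_top. exp (y * (ln (1 + z / sqrt y) - z / sqrt y)) = gamma_kernel y z"
    by eventually_elim (simp add: gamma_kernel_def)
  ultimately show ?thesis by (rule Lim_transform_eventually)
qed

text \<open>Up to a constant the function is bounded by the exponential density of rate 1/2 plus its
  reflection; both summands contribute at 0, so there the bound is not an equality.\<close>

lemma integrable_exp_neg_abs: "integrable lborel (\<lambda>z::real. exp ((1 - \<bar>z\<bar>) / 2))"
proof -
  let ?e = "erlang_density 0 (1/2)"
  have e: "integrable lborel ?e"
  proof (rule integrableI_nonneg)
    have "(\<integral>\<^sup>+ x. ennreal (?e x) \<partial>lborel) = 1"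
      using nn_integral_erlang_ith_moment[of "1/2" 0 0] by simp
    then show "(\<integral>\<^sup>+ x. ennreal (?e x) \<partial>lborel) < \<infinity>" by simp
  qed auto
  moreover have "integrable lborel (\<lambda>z. ?e (0 + (-1) * z))"
    using e by (rule lborel_integrable_real_affine) simp
  ultimately have "integrable lborel (\<lambda>z. 2 * exp (1/2) * (?e z + ?e (0 + (-1) * z)))"
    by (intro integrable_mult_right Bochner_Integration.integrable_add)
  then show ?thesis
  proof (rule Bochner_Integration.integrable_bound)
    have "norm (exp ((1 - \<bar>z\<bar>) / 2)) \<le> norm (2 * exp (1/2) * (?e z + ?e (0 + (-1) * z)))" for z :: real
    proof -
      have "exp ((1 - \<bar>z\<bar>) / 2) = 2 * exp (1/2) * (exp (- (1/2) * \<bar>z\<bar>) / 2)"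
        by (simp add: exp_add[symmetric] diff_divide_distrib)
      also have "exp (- (1/2) * \<bar>z\<bar>) / 2 \<le> ?e z + ?e (0 + (-1) * z)"
        by (simp add: erlang_density_def abs_if)
      finally show ?thesis by simp
    qed
    then show "AE z in lborel. norm (exp ((1 - \<bar>z\<bar>) / 2)) \<le> norm (2 * exp (1/2) * (?e z + ?e (0 + (-1) * z)))"
      by simp
  qed simp
qed

text \<open>The density of a gamma variable, centred at its mode \<open>y\<close> and scaled by \<open>sqrt y\<close>.\<close>

lemma gamma_density_eq_kernel:
  assumes "0 < y"
  shows "gamma_density (y + 1) (y + sqrt y * z)
    = y powr y * exp (- y) / Gamma (y + 1) * gamma_kernel y z"
proof -
  define u where "u = z / sqrt y"
  have e: "y + sqrt y * z = y * (1 + u)"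
  proof -
    have "y * u = (y / sqrt y) * z" by (simp add: u_def)
    then show ?thesis using assms by (simp add: real_div_sqrt distrib_left)
  qed
  have "(y * (1 + u)) powr y * exp (- (y * (1 + u)))
      = y powr y * exp (- y) * exp (y * (ln (1 + u) - u))" if "0 < 1 + u"
  proof -
    have "(y * (1 + u)) powr y = y powr y * exp (y * ln (1 + u))"
      using that assms by (simp add: powr_mult powr_def[of "1 + u"])
    then show ?thesis
      by (simp add: exp_add[symmetric] exp_diff exp_minus field_simps)
  qed
  then show ?thesis
    using assms unfolding e
    by (auto simp: gamma_density_def gamma_kernel_def u_def[symmetric] zero_less_mult_iff)
qed

text \<open>The affine substitution leaves an unknown constant \<open>K\<close> containing
  \<open>Gamma (y + 1)\<close>. Testing the same formula with the constant function 1 determines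
  \<open>K\<close>, because the total mass is 1.\<close>

lemma integral_gamma_distribution_eq_kernel:
  fixes u :: "real \<Rightarrow> real"
  assumes "1 \<le> y" and [measurable]: "u \<in> borel_measurable borel"
  shows "integral\<^sup>L (gamma_distribution (y + 1)) u
    = (LBINT z. gamma_kernel y z * u (y + sqrt y * z)) / (LBINT z. gamma_kernel y z)"
proof -
  define K where "K = sqrt y * (y powr y * exp (- y) / Gamma (y + 1))"
  have eq: "integral\<^sup>L (gamma_distribution (y + 1)) w = K * (LBINT z. gamma_kernel y z * w (y + sqrt y * z))"
    if [measurable]: "w \<in> borel_measurable borel" for w :: "real \<Rightarrow> real"
  proof -
    have "integral\<^sup>L (gamma_distribution (y + 1)) w
        = sqrt y * (LBINT z. gamma_density (y + 1) (y + sqrt y * z) * w (y + sqrt y * z))"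
      using assms
      by (simp add: integral_gamma_distribution)
         (subst lborel_integral_real_affine[where t=y and c="sqrt y"], auto)
    then show ?thesis
      using assms by (simp add: gamma_density_eq_kernel K_def mult.assoc)
  qed
  interpret prob_space "gamma_distribution (y + 1)"
    using assms by (intro prob_space_gamma_distribution) auto
  have "K * (LBINT z. gamma_kernel y z) = 1"
    using eq[of "\<lambda>_. 1"] prob_space by simp
  then have "K = 1 / (LBINT z. gamma_kernel y z)"
    by (metis div_by_0 mult_zero_right nonzero_eq_divide_eq zero_neq_one)
  then show ?thesis
    using eq[of u] by simp
qed

text \<open>Dominated convergence with the majorant from \<open>gamma_kernel_bound\<close>. The test
  functions may vary with \<open>n\<close>; the bound 1 suits indicators and products of
  distribution functions.\<close>

lemma LIMSEQ_integral_gamma_kernel: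
  fixes u :: "nat \<Rightarrow> real \<Rightarrow> real"
  assumes "filterlim y at_top sequentially" and y: "\<And>n. 1 \<le> y n"
    and [measurable]: "\<And>n. u n \<in> borel_measurable borel" "v \<in> borel_measurable borel"
    and bnd: "\<And>n z. \<bar>u n z\<bar> \<le> 1"
    and lim: "AE z in lborel. (\<lambda>n. u n z) \<longlonglongrightarrow> v z"
  shows "(\<lambda>n. LBINT z. gamma_kernel (y n) z * u n z) \<longlonglongrightarrow> (LBINT z. exp (- (z\<^sup>2 / 2)) * v z)"
proof (rule integral_dominated_convergence)
  show "integrable lborel (\<lambda>z::real. exp ((1 - \<bar>z\<bar>) / 2))" by (rule integrable_exp_neg_abs)
  have "gamma_kernel (y n) z * \<bar>u n z\<bar> \<le> exp ((1 - \<bar>z\<bar>) / 2) * 1" for n z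
    using y bnd gamma_kernel_bound gamma_kernel_nonneg by (intro mult_mono) auto
  then show "AE z in lborel. norm (gamma_kernel (y n) z * u n z) \<le> exp ((1 - \<bar>z\<bar>) / 2)" for n
    by (simp add: abs_mult gamma_kernel_nonneg)
  show "AE z in lborel. (\<lambda>n. gamma_kernel (y n) z * u n z) \<longlonglongrightarrow> exp (- (z\<^sup>2 / 2)) * v z"
    using lim
  proof eventually_elim
    case (elim z)
    then show ?case
      by (intro tendsto_mult filterlim_compose[OF gamma_kernel_tendsto assms(1)])
  qed
qed auto

text \<open>The common source of the limits: a test function depending on \<open>n\<close> only has
  to converge along the points standardised by the mode \<open>x n - 1\<close>, and only for almost
  every \<open>z\<close>, which leaves room for the jumps of indicators.\<close>

proposition LIMSEQ_integral_gamma_distribution: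
  fixes u :: "nat \<Rightarrow> real \<Rightarrow> real"
  assumes x: "filterlim x at_top sequentially"
    and [measurable]: "\<And>n. u n \<in> borel_measurable borel" "v \<in> borel_measurable borel"
    and bnd: "\<And>n g. \<bar>u n g\<bar> \<le> 1"
    and lim: "AE z in lborel. (\<lambda>n. u n (x n - 1 + sqrt (x n - 1) * z)) \<longlonglongrightarrow> v z"
  shows "(\<lambda>n. integral\<^sup>L (gamma_distribution (x n)) (u n)) \<longlonglongrightarrow> (LBINT z. v z * std_normal_density z)"
proof -
  \<comment> \<open>Finitely many \<open>x n\<close> may be small. The truncation makes
    \<open>1 \<le> y n\<close> hold for every \<open>n\<close> and leaves the tail of the sequence
    unchanged.\<close>
  define y where "y = (\<lambda>n. max 1 (x n - 1))"
  have ev: "\<forall>\<^sub>F n in sequentially. x n = y n + 1"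
    using filterlim_at_top_dense[THEN iffD1, OF x, rule_format, of 2]
    by eventually_elim (simp add: y_def)
  have y1: "1 \<le> y n" for n by (simp add: y_def)
  have "filterlim (\<lambda>n. - 1 + x n) at_top sequentially"
    by (rule filterlim_tendsto_add_at_top[OF tendsto_const x])
  then have y: "filterlim y at_top sequentially"
    by (rule filterlim_at_top_mono) (simp add: y_def)
  have lim': "AE z in lborel. (\<lambda>n. u n (y n + sqrt (y n) * z)) \<longlonglongrightarrow> v z"
    using lim
  proof eventually_elim
    case (elim z)
    have "\<forall>\<^sub>F n in sequentially. u n (x n - 1 + sqrt (x n - 1) * z) = u n (y n + sqrt (y n) * z)"
      using ev by eventually_elim simp
    with elim show ?case by (rule Lim_transform_eventually)
  qed
  have 1: "(\<lambda>n. LBINT z. gamma_kernel (y n) z * u n (y n + sqrt (y n) * z))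
    \<longlonglongrightarrow> (LBINT z. exp (- (z\<^sup>2 / 2)) * v z)"
    using bnd lim' by (intro LIMSEQ_integral_gamma_kernel[OF y y1]) auto
  \<comment> \<open>The test function 1 gives the limit of the denominators, the Gaussian integral
    \<open>sqrt (2 * pi)\<close>.\<close>
  have "(\<lambda>n. LBINT z. gamma_kernel (y n) z * 1) \<longlonglongrightarrow> (LBINT z. exp (- (z\<^sup>2 / 2)) * 1)"
    by (intro LIMSEQ_integral_gamma_kernel[OF y y1]) auto
  moreover have norm: "(LBINT z. exp (- (z\<^sup>2 / 2)) * w z) = sqrt (2 * pi) * (LBINT z. w z * std_normal_density z)" for w :: "real \<Rightarrow> real"
    by (subst integral_mult_right_zero[symmetric])
       (auto intro!: Bochner_Integration.integral_cong simp: std_normal_density_def)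
  ultimately have "(\<lambda>n. LBINT z. gamma_kernel (y n) z) \<longlonglongrightarrow> sqrt (2 * pi)"
    using norm[of "\<lambda>_. 1"] by simp
  with 1 have "(\<lambda>n. (LBINT z. gamma_kernel (y n) z * u n (y n + sqrt (y n) * z)) / (LBINT z. gamma_kernel (y n) z))
    \<longlonglongrightarrow> (LBINT z. exp (- (z\<^sup>2 / 2)) * v z) / sqrt (2 * pi)"
    by (intro tendsto_divide) auto
  also have "(LBINT z. exp (- (z\<^sup>2 / 2)) * v z) / sqrt (2 * pi) = (LBINT z. v z * std_normal_density z)"
    by (simp add: norm)
  finally show ?thesis
    by (rule Lim_transform_eventually)
       (use ev in eventually_elim, use y1 in \<open>simp add: integral_gamma_distribution_eq_kernel\<close>)
qed

section \<open>Gamma mixtures of Poisson variables\<close>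

lemma AE_gamma_distribution_pos: "AE g in gamma_distribution a. 0 < g"
  unfolding gamma_distribution_def
  by (subst AE_density) (auto simp: gamma_density_def)

lemma AE_gamma_distribution:
  "AE g in lborel. P g \<Longrightarrow> AE g in gamma_distribution a. P g"
  unfolding gamma_distribution_def by (subst AE_density) auto

lemma gamma_distribution_Suc:
  "gamma_distribution (real (Suc k)) = density lborel (\<lambda>x. ennreal (erlang_density k 1 x))"
  unfolding gamma_distribution_def
proof (rule density_cong)
  show "AE x in lborel. ennreal (gamma_density (real (Suc k)) x) = ennreal (erlang_density k 1 x)"
    \<comment> \<open>The two densities can differ at 0: for \<open>k = 0\<close> the Erlang density
      is 1 there, while \<open>gamma_density\<close> is 0.\<close>
    using AE_lborel_singleton[of "0::real"]
  proof eventually_elim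
    case (elim x)
    have "Gamma (1 + real k) = fact k" by (rule Gamma_fact)
    with elim show ?case
      by (auto simp: gamma_density_def erlang_density_def powr_realpow)
  qed
qed auto

lemma cdf_gamma_distribution_nonneg: "0 \<le> cdf (gamma_distribution a) x"
  by (simp add: cdf_def)

lemma cdf_gamma_distribution_le_1: "0 < a \<Longrightarrow> cdf (gamma_distribution a) x \<le> 1"
  using prob_space.prob_le_1[OF prob_space_gamma_distribution] by (simp add: cdf_def)

lemma real_distribution_gamma_distribution:
  assumes "0 < a"
  shows "real_distribution (gamma_distribution a)"
  using prob_space_gamma_distribution[OF assms]
  by (intro real_distribution.intro) (auto intro: real_distribution_axioms.intro)

lemma borel_measurable_cdf_gamma_distribution [measurable]:
  assumes "0 < a"
  shows "cdf (gamma_distribution a) \<in> borel_measurable borel"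
proof -
  interpret real_distribution "gamma_distribution a"
    by (rule real_distribution_gamma_distribution[OF assms])
  show ?thesis
    using cdf_nondecreasing by (intro borel_measurable_mono) (auto simp: mono_def)
qed

lemma borel_measurable_prod_cdf_gamma_distribution:
  fixes q :: "'i \<Rightarrow> real"
  assumes "\<And>l. l \<in> I \<Longrightarrow> 0 < a l"
  shows "(\<lambda>g. \<Prod>l\<in>I. cdf (gamma_distribution (a l)) (q l * g)) \<in> borel_measurable borel"
  using assms
  by (auto intro!: borel_measurable_prod measurable_compose[OF _ borel_measurable_cdf_gamma_distribution])

text \<open>The \<open>n\<close>-th arrival time of a Poisson process of rate 1 is Gamma(n, 1)
  distributed, and it is at most \<open>c\<close> exactly if at least \<open>n\<close> arrivals
  occur up to time \<open>c\<close>. In the proof, the Erlang distribution function is one minus a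
  partial sum of Poisson weights.\<close>

lemma cdf_gamma_distribution_eq_poisson:
  assumes "1 \<le> n" "0 < c"
  shows "cdf (gamma_distribution (real n)) c = measure (poisson_pmf c) {n..}"
proof -
  obtain k where k: "n = Suc k" using assms by (cases n) auto
  have "cdf (gamma_distribution (real n)) c = erlang_CDF k 1 c"
    unfolding k cdf_def gamma_distribution_Suc measure_def
    by (simp add: emeasure_erlang_density)
  also have "\<dots> = 1 - (\<Sum>j\<in>{..<n}. pmf (poisson_pmf c) j)"
    using assms by (simp add: erlang_CDF_def k lessThan_Suc_atMost)
  also have "\<dots> = 1 - measure (poisson_pmf c) {..<n}"
    by (simp add: measure_measure_pmf_finite)
  also have "\<dots> = measure (poisson_pmf c) (UNIV - {..<n})"
    using measure_pmf.prob_compl[of "{..<n}" "poisson_pmf c"] by simp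
  also have "UNIV - {..<n} = {n..}" by auto
  finally show ?thesis .
qed

section \<open>Negative multinomial laws as gamma mixtures of Poisson vectors\<close>

lemma nn_integral_count_space_PiE_prod:
  fixes B :: "'i \<Rightarrow> 'b :: countable set"
  assumes "finite I"
  shows "(\<integral>\<^sup>+k. (\<Prod>l\<in>I. f l (k l)) \<partial>count_space (PiE I B)) = (\<Prod>l\<in>I. \<integral>\<^sup>+j. f l j \<partial>count_space (B l))"
proof -
  \<comment> \<open>Counting measure on a finite product of countable sets is the product of the
    counting measures, so the sum of a product factors.\<close>
  interpret product_sigma_finite "\<lambda>l. count_space (B l)"
    by (intro product_sigma_finite.intro sigma_finite_measure_count_space_countable) auto
  show ?thesis
    using assms by (subst count_space_PiM_finite[symmetric]) (auto intro!: product_nn_integral_prod)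
qed

text \<open>Given the gamma variable \<open>g\<close>, the coordinates of a negative multinomial vector are
  independent Poisson variables with rates \<open>q l * g\<close>.\<close>

lemma neg_multinomial_mass_eq_mixture:
  fixes q :: "nat \<Rightarrow> real"
  assumes "finite I" "1 \<le> r" and q: "\<And>l. l \<in> I \<Longrightarrow> 0 \<le> q l"
  defines "c \<equiv> 1 + (\<Sum>l\<in>I. q l)"
  shows "ennreal (neg_multinomial_mass r I (\<lambda>l. q l / c) k)
    = (\<integral>\<^sup>+g. ennreal (\<Prod>l\<in>I. (q l * g) ^ k l / fact (k l) * exp (- (q l * g))) \<partial>gamma_distribution (real r))"
proof -
  obtain r' where r: "r = Suc r'" using assms by (cases r) auto
  have c: "0 < c" using q by (auto simp: c_def intro!: add_pos_nonneg sum_nonneg)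
  define K where "K = (\<Sum>l\<in>I. k l)"
  define D where "D = (\<Prod>l\<in>I. q l ^ k l / fact (k l)) / c ^ r"
  have D: "0 \<le> D" using q c by (auto simp: D_def intro!: divide_nonneg_nonneg prod_nonneg)
  have prod: "(\<Prod>l\<in>I. (q l * g) ^ k l / fact (k l) * exp (- (q l * g)))
      = (\<Prod>l\<in>I. q l ^ k l / fact (k l)) * g ^ K * exp (- (\<Sum>l\<in>I. q l) * g)" for g
    using assms
    by (simp add: prod.distrib power_mult_distrib prod_dividef K_def power_sum exp_sum[symmetric]
        sum_distrib_right sum_negf)
  have "(\<integral>\<^sup>+g. ennreal (\<Prod>l\<in>I. (q l * g) ^ k l / fact (k l) * exp (- (q l * g))) \<partial>gamma_distribution (real r))
      = (\<integral>\<^sup>+g. ennreal (erlang_density r' 1 g) * ennreal ((\<Prod>l\<in>I. q l ^ k l / fact (k l)) * g ^ K * exp (- (\<Sum>l\<in>I. q l) * g)) \<partial>lborel)"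
    unfolding r gamma_distribution_Suc prod by (subst nn_integral_density) auto
  \<comment> \<open>The exponential factors combine to the rate \<open>c\<close>. The Erlang density
    of rate \<open>c\<close> carries the factor \<open>c ^ r\<close>, for which \<open>D\<close>
    compensates; what remains is a \<open>K\<close>-th moment.\<close>
  also have "\<dots> = (\<integral>\<^sup>+g. ennreal D * ennreal (erlang_density r' c g * g ^ K) \<partial>lborel)"
  proof (rule nn_integral_cong)
    fix g :: real
    have "exp (- (c * g)) = exp (- g) * exp (- ((\<Sum>l\<in>I. q l) * g))"
      by (simp add: exp_add[symmetric] c_def algebra_simps)
    then have "erlang_density r' 1 g * ((\<Prod>l\<in>I. q l ^ k l / fact (k l)) * g ^ K * exp (- (\<Sum>l\<in>I. q l) * g))
       = D * (erlang_density r' c g * g ^ K)"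
      using c by (simp add: erlang_density_def D_def r)
    then show "ennreal (erlang_density r' 1 g) * ennreal ((\<Prod>l\<in>I. q l ^ k l / fact (k l)) * g ^ K * exp (- (\<Sum>l\<in>I. q l) * g))
       = ennreal D * ennreal (erlang_density r' c g * g ^ K)"
      using D by (simp only: ennreal_mult'[symmetric] erlang_density_nonneg zero_le_one)
  qed
  also have "\<dots> = ennreal D * ennreal (fact (r' + K) / (fact r' * c ^ K))"
    using c by (simp add: nn_integral_cmult nn_integral_erlang_ith_moment)
  also have "\<dots> = ennreal (D * (fact (r' + K) / (fact r' * c ^ K)))"
    using D by (rule ennreal_mult'[symmetric])
  also have "D * (fact (r' + K) / (fact r' * c ^ K)) = neg_multinomial_mass r I (\<lambda>l. q l / c) k"
  proof -
    have "1 - (\<Sum>l\<in>I. q l / c) = 1 / c"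
      using c by (simp add: sum_divide_distrib[symmetric] c_def field_simps)
    moreover have "(\<Prod>l\<in>I. (q l / c) ^ k l) = (\<Prod>l\<in>I. q l ^ k l) / c ^ K"
      by (simp add: power_divide prod_dividef K_def power_sum)
    ultimately show ?thesis
      unfolding neg_multinomial_mass_def K_def[symmetric]
      using c by (simp only: D_def r) (simp add: prod_dividef power_one_over field_simps)
  qed
  finally show ?thesis ..
qed

text \<open>Summing the mixture over the upper orthant and exchanging sum and integral, the inner
  sum splits into one Poisson tail per coordinate, and each tail is a gamma distribution
  function.\<close>

proposition measure_neg_multinomial_atLeast:
  fixes q :: "nat \<Rightarrow> real"
  assumes I: "finite I" and r: "1 \<le> r" and q: "\<And>l. l \<in> I \<Longrightarrow> 0 < q l" and b: "\<And>l. l \<in> I \<Longrightarrow> 1 \<le> b l"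
    and p: "\<And>l. l \<in> I \<Longrightarrow> p l = q l / (1 + (\<Sum>l\<in>I. q l))"
  shows "measure (neg_multinomial r I p) {k \<in> I \<rightarrow>\<^sub>E UNIV. \<forall>l\<in>I. b l \<le> k l}
    = (\<integral>g. (\<Prod>l\<in>I. cdf (gamma_distribution (real (b l))) (q l * g)) \<partial>gamma_distribution (real r))"
proof -
  let ?G = "gamma_distribution (real r)"
  let ?f = "\<lambda>l g j. (q l * g) ^ j / fact j * exp (- (q l * g))"
  let ?E = "PiE I (\<lambda>l. {b l..})"
  interpret G: prob_space ?G using r by (intro prob_space_gamma_distribution) auto
  have cE: "countable ?E" using I by (intro countable_PiE) auto
  interpret P: pair_sigma_finite "count_space ?E" ?G
    by (intro pair_sigma_finite.intro G.sigma_finite_measure_axioms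
        sigma_finite_measure_count_space_countable cE)
  have mass: "neg_multinomial_mass r I p k = neg_multinomial_mass r I (\<lambda>l. q l / (1 + (\<Sum>l\<in>I. q l))) k" for k
    unfolding neg_multinomial_mass_def using p by simp
  have set: "{k \<in> I \<rightarrow>\<^sub>E UNIV. \<forall>l\<in>I. b l \<le> k l} = ?E"
    by (auto simp: PiE_def Pi_def)
  have "emeasure (neg_multinomial r I p) ?E
      = (\<integral>\<^sup>+k. ennreal (neg_multinomial_mass r I p k) * indicator ?E k \<partial>count_space (I \<rightarrow>\<^sub>E UNIV))"
    unfolding neg_multinomial_def by (subst emeasure_density) auto
  also have "\<dots> = (\<integral>\<^sup>+k. ennreal (neg_multinomial_mass r I p k) \<partial>count_space ?E)"
    by (subst (1 2) nn_integral_count_space_indicator)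
       (auto intro!: nn_integral_cong simp: PiE_def split: split_indicator)
  also have "\<dots> = (\<integral>\<^sup>+k. \<integral>\<^sup>+g. ennreal (\<Prod>l\<in>I. ?f l g (k l)) \<partial>?G \<partial>count_space ?E)"
    unfolding mass using assms
    by (intro nn_integral_cong neg_multinomial_mass_eq_mixture) (auto intro: less_imp_le)
  also have "\<dots> = (\<integral>\<^sup>+g. \<integral>\<^sup>+k. ennreal (\<Prod>l\<in>I. ?f l g (k l)) \<partial>count_space ?E \<partial>?G)"
  proof (rule P.Fubini'[symmetric])
    show "(\<lambda>(k, g). ennreal (\<Prod>l\<in>I. ?f l g (k l))) \<in> borel_measurable (count_space ?E \<Otimes>\<^sub>M ?G)"
      by (rule measurable_pair_measure_countable1[OF cE]) simp
  qed
  also have "\<dots> = (\<integral>\<^sup>+g. ennreal (\<Prod>l\<in>I. cdf (gamma_distribution (real (b l))) (q l * g)) \<partial>?G)"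
  proof (rule nn_integral_cong_AE)
    show "AE g in ?G. (\<integral>\<^sup>+k. ennreal (\<Prod>l\<in>I. ?f l g (k l)) \<partial>count_space ?E)
       = ennreal (\<Prod>l\<in>I. cdf (gamma_distribution (real (b l))) (q l * g))"
      \<comment> \<open>The Poisson rates \<open>q l * g\<close> have to be positive, which holds
        for almost every \<open>g\<close>.\<close>
      using AE_gamma_distribution_pos
    proof eventually_elim
      case (elim g)
      have "(\<integral>\<^sup>+k. ennreal (\<Prod>l\<in>I. ?f l g (k l)) \<partial>count_space ?E)
          = (\<integral>\<^sup>+k. (\<Prod>l\<in>I. ennreal (?f l g (k l))) \<partial>count_space ?E)"
        using q elim by (intro nn_integral_cong prod_ennreal[symmetric]) (auto simp: less_imp_le)
      also have "\<dots> = (\<Prod>l\<in>I. \<integral>\<^sup>+j. ennreal (?f l g j) \<partial>count_space {b l..})"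
        by (rule nn_integral_count_space_PiE_prod[OF I])
      also have "\<dots> = (\<Prod>l\<in>I. ennreal (cdf (gamma_distribution (real (b l))) (q l * g)))"
      proof (rule prod.cong)
        fix l assume l: "l \<in> I"
        have pos: "0 < q l * g" using q[OF l] elim by simp
        have "(\<integral>\<^sup>+j. ennreal (?f l g j) \<partial>count_space {b l..})
            = (\<integral>\<^sup>+j. ennreal (pmf (poisson_pmf (q l * g)) j) \<partial>count_space {b l..})"
          using pos by simp
        also have "\<dots> = ennreal (measure (poisson_pmf (q l * g)) {b l..})"
          by (simp add: nn_integral_pmf measure_pmf.emeasure_eq_measure)
        finally show "(\<integral>\<^sup>+j. ennreal (?f l g j) \<partial>count_space {b l..})
            = ennreal (cdf (gamma_distribution (real (b l))) (q l * g))"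
          using pos b[OF l] by (simp add: cdf_gamma_distribution_eq_poisson)
      qed simp
      also have "\<dots> = ennreal (\<Prod>l\<in>I. cdf (gamma_distribution (real (b l))) (q l * g))"
        by (intro prod_ennreal cdf_gamma_distribution_nonneg)
      finally show ?case .
    qed
  qed
  finally show ?thesis
    unfolding set measure_def
    using b
    by (subst integral_eq_nn_integral)
       (auto simp: Suc_le_eq intro!: prod_nonneg cdf_gamma_distribution_nonneg borel_measurable_prod
         measurable_compose[OF _ borel_measurable_cdf_gamma_distribution])
qed

section \<open>Both versions of \<tau>_1 as one gamma mixture\<close>

definition tau1_mixture :: "nat \<Rightarrow> (nat \<Rightarrow> real) \<Rightarrow> real" where
  "tau1_mixture m x =
     (\<integral>g. (\<Prod>l=2..m. cdf (gamma_distribution (x l)) (x l / x 1 * g)) \<partial>gamma_distribution (x 1))"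

text \<open>With \<open>q l = n l / n 1\<close> the sum of all parameters is
  \<open>n 1 * (1 + (\<Sum>l=2..m. q l))\<close>, so the cell probabilities have the form required
  by \<open>measure_neg_multinomial_atLeast\<close>.\<close>

lemma tau1_eq_mixture:
  assumes "2 \<le> m" and n: "\<And>k. k \<in> {1..m} \<Longrightarrow> 1 \<le> n k"
  shows "tau1 m n = tau1_mixture m (\<lambda>k. real (n k))"
  unfolding tau1_def tau1_mixture_def
proof (rule measure_neg_multinomial_atLeast)
  have n1: "0 < n 1" using n[of 1] assms(1) by simp
  have "{1..m} = insert 1 {2..m}" using assms by auto
  then have "real (\<Sum>j=1..m. n j) = real (n 1) + (\<Sum>j=2..m. real (n j))"
    by simp
  also have "\<dots> = real (n 1) * (1 + (\<Sum>l=2..m. real (n l) / real (n 1)))"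
    using n1 by (simp add: sum_divide_distrib[symmetric] field_simps)
  finally show "real (n l) / real (\<Sum>j=1..m. n j) = real (n l) / real (n 1) / (1 + (\<Sum>l=2..m. real (n l) / real (n 1)))" for l
    by simp
  show "0 < real (n l) / real (n 1)" if "l \<in> {2..m}" for l
    using n[of l] that n1 by simp
qed (use assms in auto)

text \<open>Given the value \<open>y\<close> of the first coordinate, the event is a box with upper
  edges \<open>x l / x 1 * y\<close>; by independence its probability is a product of distribution
  functions.\<close>

lemma tau1_real_eq_mixture:
  assumes "2 \<le> m" and x: "\<And>k. k \<in> {1..m} \<Longrightarrow> 0 < x k"
  shows "tau1_real m x = tau1_mixture m x"
proof -
  \<comment> \<open>The value 1 outside \<open>{1..m}\<close> makes every \<open>M j\<close> a
    probability measure, so that \<open>M\<close> satisfies \<open>product_sigma_finite\<close> on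
    all indices.\<close>
  define M where "M = (\<lambda>j. gamma_distribution (if j \<in> {1..m} then x j else 1))"
  have PiM_M: "Pi\<^sub>M {1..m} (\<lambda>j. gamma_distribution (x j)) = Pi\<^sub>M {1..m} M"
    by (intro PiM_cong) (auto simp: M_def)
  have M: "prob_space (M j)" for j
    unfolding M_def using x by (intro prob_space_gamma_distribution) auto
  interpret product_sigma_finite M
    by (intro product_sigma_finite.intro prob_space_imp_sigma_finite M)
  have M_l: "M l = gamma_distribution (x l)" if "l \<in> {1..m}" for l
    using that by (simp add: M_def)
  have x1: "0 < x 1" using x[of 1] assms(1) by simp
  have ins: "insert 1 {2..m} = {1..m}" using assms by auto
  let ?A = "{g \<in> space (Pi\<^sub>M {1..m} M). \<forall>l\<in>{2..m}. g l / x l \<le> g 1 / x 1}"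
  have [measurable_cong]: "sets (M j) = sets borel" for j by (simp add: M_def)
  have [simp]: "space (M j) = UNIV" for j by (simp add: M_def)
  have A: "?A \<in> sets (Pi\<^sub>M {1..m} M)"
  proof (intro sets.sets_Collect_finite_All)
    fix l assume l: "l \<in> {2..m}"
    have [measurable]: "(\<lambda>g. g 1) \<in> borel_measurable (Pi\<^sub>M {1..m} M)"
        "(\<lambda>g. g l) \<in> borel_measurable (Pi\<^sub>M {1..m} M)"
      using measurable_component_singleton[of 1 "{1..m}" M] measurable_component_singleton[of l "{1..m}" M] l
      by (auto cong: measurable_cong_sets)
    show "{g \<in> space (Pi\<^sub>M {1..m} M). g l / x l \<le> g 1 / x 1} \<in> sets (Pi\<^sub>M {1..m} M)"
      by measurable
  qed simp
  have "emeasure (Pi\<^sub>M {1..m} M) ?A = (\<integral>\<^sup>+g. indicator ?A g \<partial>Pi\<^sub>M (insert 1 {2..m}) M)"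
    using A unfolding ins by simp
  also have "\<dots> = (\<integral>\<^sup>+y. (\<integral>\<^sup>+g. indicator ?A (g(1 := y)) \<partial>Pi\<^sub>M {2..m} M) \<partial>M 1)"
    by (intro product_nn_integral_insert_rev borel_measurable_indicator) (use A in \<open>auto simp only: ins\<close>, auto)
  also have "\<dots> = (\<integral>\<^sup>+y. ennreal (\<Prod>l=2..m. cdf (gamma_distribution (x l)) (x l / x 1 * y)) \<partial>M 1)"
  proof (rule nn_integral_cong)
    fix y :: real
    have "(\<integral>\<^sup>+g. indicator ?A (g(1 := y)) \<partial>Pi\<^sub>M {2..m} M)
        = (\<integral>\<^sup>+g. indicator (PiE {2..m} (\<lambda>l. {..x l / x 1 * y})) g \<partial>Pi\<^sub>M {2..m} M)"
    proof (rule nn_integral_cong)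
      fix g assume g: "g \<in> space (Pi\<^sub>M {2..m} M)"
      then have "g(1 := y) \<in> space (Pi\<^sub>M {1..m} M)"
        using assms by (auto simp: space_PiM PiE_def extensional_def)
      moreover have "g l / x l \<le> y / x 1 \<longleftrightarrow> g l \<le> x l / x 1 * y" if "l \<in> {2..m}" for l
        using x[of l] that x1 by (simp add: field_simps)
      ultimately have "g(1 := y) \<in> ?A \<longleftrightarrow> g \<in> PiE {2..m} (\<lambda>l. {..x l / x 1 * y})"
        using g by (auto simp: space_PiM PiE_def)
      then show "(indicator ?A (g(1 := y)) :: ennreal) = indicator (PiE {2..m} (\<lambda>l. {..x l / x 1 * y})) g"
        by (simp add: indicator_def)
    qed
    also have "\<dots> = emeasure (Pi\<^sub>M {2..m} M) (PiE {2..m} (\<lambda>l. {..x l / x 1 * y}))"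
      by (intro nn_integral_indicator sets_PiM_I_finite) (auto simp: M_def)
    also have "\<dots> = (\<Prod>l=2..m. emeasure (M l) {..x l / x 1 * y})"
      by (intro emeasure_PiM) (auto simp: M_def)
    also have "\<dots> = (\<Prod>l=2..m. ennreal (cdf (gamma_distribution (x l)) (x l / x 1 * y)))"
    proof (rule prod.cong)
      fix l assume "l \<in> {2..m}"
      then have "M l = gamma_distribution (x l)" by (simp add: M_l)
      then show "emeasure (M l) {..x l / x 1 * y} = ennreal (cdf (gamma_distribution (x l)) (x l / x 1 * y))"
        using M[of l]
        by (simp add: cdf_def finite_measure.emeasure_eq_measure prob_space.finite_measure)
    qed simp
    also have "\<dots> = ennreal (\<Prod>l=2..m. cdf (gamma_distribution (x l)) (x l / x 1 * y))"
      by (intro prod_ennreal cdf_gamma_distribution_nonneg)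
    finally show "(\<integral>\<^sup>+g. indicator ?A (g(1 := y)) \<partial>Pi\<^sub>M {2..m} M)
        = ennreal (\<Prod>l=2..m. cdf (gamma_distribution (x l)) (x l / x 1 * y))" .
  qed
  also have "M 1 = gamma_distribution (x 1)" using assms by (simp add: M_l)
  finally show ?thesis
    unfolding tau1_real_def tau1_mixture_def Let_def PiM_M measure_def
    using x
    by (subst integral_eq_nn_integral)
       (auto intro!: prod_nonneg cdf_gamma_distribution_nonneg borel_measurable_prod
         measurable_compose[OF _ borel_measurable_cdf_gamma_distribution])
qed

section \<open>Limits of gamma distribution functions\<close>

lemma measure_gamma_distribution_singleton: "measure (gamma_distribution a) {x} = 0"
proof -
  have "emeasure (gamma_distribution a) {x} = (\<integral>\<^sup>+t. ennreal (gamma_density a t) * indicator {x} t \<partial>lborel)"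
    by (simp add: gamma_distribution_def emeasure_density)
  also have "\<dots> = integral\<^sup>N (lborel :: real measure) (\<lambda>_. 0)"
  proof (rule nn_integral_cong_AE)
    show "AE t in lborel. ennreal (gamma_density a t) * indicator {x} t = 0"
      using AE_lborel_singleton[of x] by eventually_elim auto
  qed
  finally show ?thesis by (simp add: measure_def)
qed

lemma isCont_cdf_gamma_distribution:
  assumes "0 < a"
  shows "isCont (cdf (gamma_distribution a)) x"
proof -
  interpret real_distribution "gamma_distribution a"
    by (rule real_distribution_gamma_distribution[OF assms])
  show ?thesis by (simp add: isCont_cdf measure_gamma_distribution_singleton)
qed

lemma prod_cdf_gamma_distribution_le_1:
  assumes "\<And>l. l \<in> I \<Longrightarrow> 0 < a l"
  shows "\<bar>\<Prod>l\<in>I. cdf (gamma_distribution (a l)) (c l)\<bar> \<le> 1"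
  using assms
  by (auto simp: abs_prod cdf_gamma_distribution_nonneg cdf_gamma_distribution_le_1 intro!: prod_le_1)

lemma integral_indicator_atMost_gamma_distribution:
  "integral\<^sup>L (gamma_distribution a) (indicator {..c}) = cdf (gamma_distribution a) c"
  by (simp add: cdf_def)

text \<open>A central limit theorem for gamma variables with growing shape. At the standardised
  points, the indicator of \<open>{..c n}\<close> compares \<open>z\<close> with the standardised
  bound, hence eventually with \<open>w\<close>.\<close>

lemma cdf_gamma_distribution_tendsto_normal:
  assumes x: "filterlim x at_top sequentially"
    and c: "(\<lambda>n. (c n - (x n - 1)) / sqrt (x n - 1)) \<longlonglongrightarrow> w"
  shows "(\<lambda>n. cdf (gamma_distribution (x n)) (c n)) \<longlonglongrightarrow> cdf std_normal_distribution w"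
proof -
  have "(\<lambda>n. integral\<^sup>L (gamma_distribution (x n)) (indicator {..c n}))
      \<longlonglongrightarrow> (LBINT z. indicator {..w} z * std_normal_density z)"
  proof (rule LIMSEQ_integral_gamma_distribution[OF x])
    show "AE z in lborel. (\<lambda>n. indicator {..c n} (x n - 1 + sqrt (x n - 1) * z) :: real) \<longlonglongrightarrow> indicator {..w} z"
      \<comment> \<open>At \<open>z = w\<close> the indicators may fail to converge.\<close>
      using AE_lborel_singleton[of w]
    proof eventually_elim
      case (elim z)
      have 1: "\<forall>\<^sub>F n in sequentially. 1 < x n"
        using x by (simp add: filterlim_at_top_dense)
      have 2: "\<forall>\<^sub>F n in sequentially. (z \<le> (c n - (x n - 1)) / sqrt (x n - 1)) = (z \<le> w)"
      proof (cases "w < z")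
        case True
        with order_tendstoD(2)[OF c True] show ?thesis
          by (auto elim!: eventually_mono)
      next
        case False
        with elim have "z < w" by simp
        with order_tendstoD(1)[OF c this] show ?thesis
          by (auto elim!: eventually_mono)
      qed
      have "\<forall>\<^sub>F n in sequentially. (indicator {..w} z :: real) = indicator {..c n} (x n - 1 + sqrt (x n - 1) * z)"
        using 1 2
      proof eventually_elim
        case (elim n)
        have "x n - 1 + sqrt (x n - 1) * z \<le> c n \<longleftrightarrow> z \<le> (c n - (x n - 1)) / sqrt (x n - 1)"
          using elim(1) by (simp add: le_divide_eq algebra_simps)
        then show ?case
          using elim(2) by (auto simp: indicator_def)
      qed
      then show ?case by (rule tendsto_eventually[OF eventually_mono]) simp
    qed
  qed (auto simp: indicator_def)
  also have "(LBINT z. indicator {..w} z * std_normal_density z) = integral\<^sup>L std_normal_distribution (indicator {..w})"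
    by (subst integral_density) (auto simp: mult.commute)
  finally show ?thesis
    by (simp add: integral_indicator_atMost_gamma_distribution cdf_def)
qed

text \<open>The law of large numbers for Gamma(n, 1). Fluctuations of order \<open>sqrt n\<close>
  are negligible against \<open>n * \<bar>c - 1\<bar>\<close>, so the limiting test function is
  constant in \<open>z\<close>.\<close>

lemma cdf_gamma_distribution_LLN:
  assumes "c \<noteq> 1"
  shows "(\<lambda>n. cdf (gamma_distribution (real n)) (real n * c)) \<longlonglongrightarrow> indicator {1<..} c"
proof -
  have "(\<lambda>n. integral\<^sup>L (gamma_distribution (real n)) (indicator {..real n * c}))
      \<longlonglongrightarrow> (LBINT z. indicator {1<..} c * std_normal_density z)"
  proof (rule LIMSEQ_integral_gamma_distribution[OF filterlim_real_sequentially])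
    have "\<forall>\<^sub>F n in sequentially. (real n - 1 + sqrt (real n - 1) * z \<le> real n * c) = (1 < c)" for z
    proof -
      have lim: "(\<lambda>n. (real n - 1 + sqrt (real n - 1) * z) / real n) \<longlonglongrightarrow> 1"
        by real_asymp
      have "\<forall>\<^sub>F n in sequentially. ((real n - 1 + sqrt (real n - 1) * z) / real n \<le> c) = (1 < c)"
      proof (cases "1 < c")
        case True
        with order_tendstoD(2)[OF lim True] show ?thesis
          by (auto elim!: eventually_mono)
      next
        case False
        with assms have "c < 1" by simp
        with order_tendstoD(1)[OF lim this] show ?thesis
          by (auto elim!: eventually_mono)
      qed
      with eventually_gt_at_top[of 0] show ?thesis
        by eventually_elim (simp add: divide_le_eq mult.commute)
    qed
    then have "\<forall>\<^sub>F n in sequentially. indicator {..real n * c} (real n - 1 + sqrt (real n - 1) * z) = (indicator {1<..} c :: real)" for z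
      by (rule eventually_mono) (auto simp: indicator_def)
    then show "AE z in lborel. (\<lambda>n. indicator {..real n * c} (real n - 1 + sqrt (real n - 1) * z) :: real) \<longlonglongrightarrow> indicator {1<..} c"
      by (intro AE_I2 tendsto_eventually)
  qed (auto simp: indicator_def)
  then show ?thesis
    by (simp add: cdf_def)
qed

section \<open>Growth of the first parameter, and proportional growth of all parameters\<close>

theorem LIMSEQ_tau1_first:
  assumes "2 \<le> m" and n: "\<And>k. k \<in> {2..m} \<Longrightarrow> 1 \<le> n k"
  shows "(\<lambda>N. tau1 m (n(1 := N))) \<longlonglongrightarrow> (\<Prod>k=2..m. cdf (gamma_distribution (real (n k))) (real (n k)))"
proof -
  have pos: "0 < real (n l)" if "l \<in> {2..m}" for l using n[OF that] by simp
  have "(\<lambda>N. \<integral>g. (\<Prod>l=2..m. cdf (gamma_distribution (real (n l))) (real (n l) / real N * g)) \<partial>gamma_distribution (real N))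
     \<longlonglongrightarrow> (LBINT z. (\<Prod>k=2..m. cdf (gamma_distribution (real (n k))) (real (n k))) * std_normal_density z)"
  proof (rule LIMSEQ_integral_gamma_distribution[OF filterlim_real_sequentially])
    \<comment> \<open>The mixing variable divided by \<open>N\<close> tends to 1 at every fixed
      \<open>z\<close>. By continuity of the distribution functions the limit is a constant, which
      the normal density integrates to itself.\<close>
    have "(\<lambda>N. \<Prod>l=2..m. cdf (gamma_distribution (real (n l)))
              (real (n l) / real N * (real N - 1 + sqrt (real N - 1) * z)))
          \<longlonglongrightarrow> (\<Prod>k=2..m. cdf (gamma_distribution (real (n k))) (real (n k)))" for z
    proof (intro tendsto_prod isCont_tendsto_compose[OF isCont_cdf_gamma_distribution] pos)
      fix l
      have "(\<lambda>N. (real N - 1 + sqrt (real N - 1) * z) / real N) \<longlonglongrightarrow> 1"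
        by real_asymp
      then have "(\<lambda>N. real (n l) * ((real N - 1 + sqrt (real N - 1) * z) / real N)) \<longlonglongrightarrow> real (n l) * 1"
        by (intro tendsto_mult_left)
      then show "(\<lambda>N. real (n l) / real N * (real N - 1 + sqrt (real N - 1) * z)) \<longlonglongrightarrow> real (n l)"
        by simp
    qed
    then show "AE z in lborel. (\<lambda>N. \<Prod>l=2..m. cdf (gamma_distribution (real (n l)))
              (real (n l) / real N * (real N - 1 + sqrt (real N - 1) * z)))
          \<longlonglongrightarrow> (\<Prod>k=2..m. cdf (gamma_distribution (real (n k))) (real (n k)))"
      by (rule AE_I2)
  qed (use pos in \<open>auto intro!: prod_cdf_gamma_distribution_le_1 borel_measurable_prod_cdf_gamma_distribution\<close>)
  moreover have "\<forall>\<^sub>F N in sequentially. (\<integral>g. (\<Prod>l=2..m. cdf (gamma_distribution (real (n l))) (real (n l) / real N * g)) \<partial>gamma_distribution (real N))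
     = tau1 m (n(1 := N))"
    using eventually_ge_at_top[of 1]
  proof eventually_elim
    case (elim N)
    then have "tau1 m (n(1 := N)) = tau1_mixture m (\<lambda>k. real ((n(1 := N)) k))"
      using n by (intro tau1_eq_mixture[OF assms(1)]) auto
    also have "\<dots> = (\<integral>g. (\<Prod>l=2..m. cdf (gamma_distribution (real (n l))) (real (n l) / real N * g)) \<partial>gamma_distribution (real N))"
      unfolding tau1_mixture_def by (auto intro!: Bochner_Integration.integral_cong prod.cong)
    finally show ?case ..
  qed
  ultimately show ?thesis by (simp add: Lim_transform_eventually)
qed

text \<open>To leading order the mixing variable is
  \<open>\<alpha> 1 * n + sqrt (\<alpha> 1 * n) * z\<close>. Multiplied by
  \<open>\<alpha> l / \<alpha> 1\<close>, its fluctuation is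
  \<open>sqrt (\<alpha> l / \<alpha> 1) * z\<close> in units of
  \<open>sqrt (\<alpha> l * n)\<close>, the scale of the \<open>l\<close>-th gamma variable.\<close>

theorem LIMSEQ_tau1_real:
  fixes \<alpha> :: "nat \<Rightarrow> real"
  assumes "2 \<le> m" and \<alpha>: "\<And>k. k \<in> {1..m} \<Longrightarrow> 0 < \<alpha> k"
  shows "(\<lambda>n. tau1_real m (\<lambda>j. \<alpha> j * real n))
    \<longlonglongrightarrow> (LBINT z. (\<Prod>k=2..m. cdf std_normal_distribution (sqrt (\<alpha> k / \<alpha> 1) * z)) * std_normal_density z)"
proof -
  have \<alpha>1: "0 < \<alpha> 1" using \<alpha>[of 1] assms(1) by simp
  \<comment> \<open>The shift to \<open>Suc n\<close> avoids the shape parameter 0 at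
    \<open>n = 0\<close>; it is undone at the end.\<close>
  have pos: "0 < \<alpha> l * real (Suc n)" if "l \<in> {2..m}" for l n
    using \<alpha>[of l] that by simp
  interpret std: real_distribution std_normal_distribution by (rule real_dist_normal_dist)
  have [measurable]: "cdf std_normal_distribution \<in> borel_measurable borel"
    using std.cdf_nondecreasing by (intro borel_measurable_mono) (auto simp: mono_def)
  have lin: "filterlim (\<lambda>n. a * real (Suc n)) at_top sequentially" if "0 < a" for a :: real
    using that by real_asymp
  have "(\<lambda>n. \<integral>g. (\<Prod>l=2..m. cdf (gamma_distribution (\<alpha> l * real (Suc n)))
          ((\<alpha> l * real (Suc n)) / (\<alpha> 1 * real (Suc n)) * g)) \<partial>gamma_distribution (\<alpha> 1 * real (Suc n)))
     \<longlonglongrightarrow> (LBINT z. (\<Prod>k=2..m. cdf std_normal_distribution (sqrt (\<alpha> k / \<alpha> 1) * z)) * std_normal_density z)"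
  proof (rule LIMSEQ_integral_gamma_distribution[OF lin[OF \<alpha>1]])
    have "(\<lambda>n. \<Prod>l=2..m. cdf (gamma_distribution (\<alpha> l * real (Suc n)))
          ((\<alpha> l * real (Suc n)) / (\<alpha> 1 * real (Suc n)) *
             (\<alpha> 1 * real (Suc n) - 1 + sqrt (\<alpha> 1 * real (Suc n) - 1) * z)))
       \<longlonglongrightarrow> (\<Prod>k=2..m. cdf std_normal_distribution (sqrt (\<alpha> k / \<alpha> 1) * z))" for z
    proof (intro tendsto_prod cdf_gamma_distribution_tendsto_normal lin)
      fix l assume l: "l \<in> {2..m}"
      define a where "a = \<alpha> l"
      define b where "b = \<alpha> 1"
      have ab: "0 < a" "0 < b" using \<alpha>[of l] l \<alpha>1 by (auto simp: a_def b_def)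
      show "0 < \<alpha> l" using ab by (simp add: a_def)
      \<comment> \<open>The standardised argument splits into an offset, which stems from centring
        at modes instead of means and vanishes in the limit, and a term linear in
        \<open>z\<close>.\<close>
      have "(\<lambda>n. (1 - a / b) * (1 / sqrt (a * real (Suc n) - 1))
              + a / b * (sqrt (b * real (Suc n) - 1) / sqrt (a * real (Suc n) - 1)) * z)
          \<longlonglongrightarrow> (1 - a / b) * 0 + a / b * (sqrt b / sqrt a) * z"
      proof (intro tendsto_add tendsto_mult tendsto_const)
        show "(\<lambda>n. 1 / sqrt (a * real (Suc n) - 1)) \<longlonglongrightarrow> 0" using ab by real_asymp
        have "(\<lambda>n. (b * real (Suc n) - 1) / (a * real (Suc n) - 1)) \<longlonglongrightarrow> b / a"
          using ab by (real_asymp simp: divide_inverse mult.commute)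
        then show "(\<lambda>n. sqrt (b * real (Suc n) - 1) / sqrt (a * real (Suc n) - 1)) \<longlonglongrightarrow> sqrt b / sqrt a"
          unfolding real_sqrt_divide[symmetric] by (rule tendsto_real_sqrt)
      qed
      also have "a / b * (sqrt b / sqrt a) = (a / sqrt a) / (b / sqrt b)" by simp
      also have "\<dots> = sqrt (a / b)" using ab by (simp add: real_div_sqrt real_sqrt_divide)
      also have "(\<lambda>n. (1 - a / b) * (1 / sqrt (a * real (Suc n) - 1))
              + a / b * (sqrt (b * real (Suc n) - 1) / sqrt (a * real (Suc n) - 1)) * z)
          = (\<lambda>n. ((a * real (Suc n)) / (b * real (Suc n)) * (b * real (Suc n) - 1 + sqrt (b * real (Suc n) - 1) * z)
               - (a * real (Suc n) - 1)) / sqrt (a * real (Suc n) - 1))"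
      proof
        fix n
        define N where "N = real (Suc n)"
        have N: "0 < N" by (simp add: N_def)
        have eq: "(a * N) / (b * N) * (b * N - 1 + sqrt (b * N - 1) * z) - (a * N - 1)
            = (1 - a / b) + a / b * sqrt (b * N - 1) * z"
          using ab N by (simp add: field_simps)
        then show "(1 - a / b) * (1 / sqrt (a * real (Suc n) - 1))
              + a / b * (sqrt (b * real (Suc n) - 1) / sqrt (a * real (Suc n) - 1)) * z
          = ((a * real (Suc n)) / (b * real (Suc n)) * (b * real (Suc n) - 1 + sqrt (b * real (Suc n) - 1) * z)
               - (a * real (Suc n) - 1)) / sqrt (a * real (Suc n) - 1)"
          unfolding N_def[symmetric] eq by (simp add: add_divide_distrib)
      qed
      finally show "(\<lambda>n. ((\<alpha> l * real (Suc n)) / (\<alpha> 1 * real (Suc n)) * (\<alpha> 1 * real (Suc n) - 1 + sqrt (\<alpha> 1 * real (Suc n) - 1) * z)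
               - (\<alpha> l * real (Suc n) - 1)) / sqrt (\<alpha> l * real (Suc n) - 1)) \<longlonglongrightarrow> sqrt (\<alpha> l / \<alpha> 1) * z"
        by (simp add: a_def b_def)
    qed
    then show "AE z in lborel. (\<lambda>n. \<Prod>l=2..m. cdf (gamma_distribution (\<alpha> l * real (Suc n)))
          ((\<alpha> l * real (Suc n)) / (\<alpha> 1 * real (Suc n)) *
             (\<alpha> 1 * real (Suc n) - 1 + sqrt (\<alpha> 1 * real (Suc n) - 1) * z)))
       \<longlonglongrightarrow> (\<Prod>k=2..m. cdf std_normal_distribution (sqrt (\<alpha> k / \<alpha> 1) * z))"
      by (rule AE_I2)
    show "(\<lambda>z. \<Prod>k=2..m. cdf std_normal_distribution (sqrt (\<alpha> k / \<alpha> 1) * z)) \<in> borel_measurable borel"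
      by measurable
  qed (use pos in \<open>auto intro!: prod_cdf_gamma_distribution_le_1 borel_measurable_prod_cdf_gamma_distribution simp del: of_nat_Suc\<close>)
  moreover have "tau1_real m (\<lambda>j. \<alpha> j * real (Suc n)) = tau1_mixture m (\<lambda>j. \<alpha> j * real (Suc n))" for n
    using \<alpha> by (intro tau1_real_eq_mixture[OF assms(1)]) simp
  ultimately have "(\<lambda>n. tau1_real m (\<lambda>j. \<alpha> j * real (Suc n)))
    \<longlonglongrightarrow> (LBINT z. (\<Prod>k=2..m. cdf std_normal_distribution (sqrt (\<alpha> k / \<alpha> 1) * z)) * std_normal_density z)"
    by (simp only: tau1_mixture_def)
  then show ?thesis by (rule LIMSEQ_imp_Suc)
qed

section \<open>The inverted Dirichlet distribution\<close>

lemma Gamma_real_of_nat: "1 \<le> n \<Longrightarrow> Gamma (real n) = fact (n - 1)"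
  using Gamma_fact[of "n - 1", where 'a = real] by (cases n) auto

lemma nn_integral_erlang_density_1:
  assumes "0 < l"
  shows "(\<integral>\<^sup>+x. ennreal (erlang_density k l x) \<partial>lborel) = 1"
  using nn_integral_erlang_ith_moment[OF assms, of k 0] by simp

lemma gamma_distribution_of_nat:
  "1 \<le> n \<Longrightarrow> gamma_distribution (real n) = density lborel (\<lambda>x. ennreal (erlang_density (n - 1) 1 x))"
  using gamma_distribution_Suc[of "n - 1"] by (cases n) auto

text \<open>If G is Gamma(n, 1) distributed, then G / g is Erlang distributed with rate
  \<open>g\<close>. Dividing by \<open>g\<close> turns the moving bound \<open>q * g\<close> into
  the fixed bound \<open>q\<close>.\<close>

lemma cdf_gamma_distribution_eq_nn_integral:
  assumes "1 \<le> n" "0 < g"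
  shows "ennreal (cdf (gamma_distribution (real n)) (q * g))
    = (\<integral>\<^sup>+s. ennreal (erlang_density (n - 1) g s) * indicator {..q} s \<partial>lborel)"
proof -
  have "cdf (gamma_distribution (real n)) (q * g) = erlang_CDF (n - 1) 1 (g * q)"
    using assms
    by (simp add: gamma_distribution_of_nat cdf_def measure_def emeasure_erlang_density mult.commute)
  then show ?thesis
    using assms by (simp only: nn_integral_erlang_density erlang_CDF_transform[of g])
qed

text \<open>In the variables \<open>s l = G l / g\<close> the joint density of independent gamma variables factors
  into the inverted Dirichlet density and a gamma density with rate \<open>1 + (\<Sum>l. s l)\<close>.\<close>

lemma erlang_prod_eq_inverted_dirichlet:
  assumes "finite I" "1 \<le> r" and n: "\<And>l. l \<in> I \<Longrightarrow> 1 \<le> n l"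
  shows "erlang_density (r - 1) 1 g * (\<Prod>l\<in>I. erlang_density (n l - 1) g (s l))
    = inverted_dirichlet_density I n r s * erlang_density (r + (\<Sum>l\<in>I. n l) - 1) (1 + (\<Sum>l\<in>I. s l)) g"
proof (cases "0 \<le> g \<and> (\<forall>l\<in>I. 0 \<le> s l)")
  case True
  define c where "c = 1 + (\<Sum>l\<in>I. s l)"
  define A where "A = r + (\<Sum>l\<in>I. n l)"
  have c: "0 < c" using True by (auto simp: c_def intro!: add_pos_nonneg sum_nonneg)
  have A: "1 \<le> A" "Suc (A - 1) = A" using assms by (auto simp: A_def)
  have "(\<Prod>l\<in>I. erlang_density (n l - 1) g (s l))
      = (\<Prod>l\<in>I. g ^ n l * s l ^ (n l - 1) * exp (- g * s l) / fact (n l - 1))"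
  proof (rule prod.cong)
    fix l assume "l \<in> I"
    then have "Suc (n l - 1) = n l" using n[of l] by simp
    with True \<open>l \<in> I\<close> show "erlang_density (n l - 1) g (s l) = g ^ n l * s l ^ (n l - 1) * exp (- g * s l) / fact (n l - 1)"
      by (auto simp: erlang_density_def)
  qed simp
  also have "\<dots> = g ^ (\<Sum>l\<in>I. n l) * (\<Prod>l\<in>I. s l ^ (n l - 1)) * exp (- g * (\<Sum>l\<in>I. s l)) / (\<Prod>l\<in>I. fact (n l - 1))"
    using assms(1) by (simp add: prod_dividef prod.distrib power_sum exp_sum sum_distrib_left sum_negf[symmetric])
  finally have 1: "(\<Prod>l\<in>I. erlang_density (n l - 1) g (s l)) = \<dots>" .
  have 2: "erlang_density (r - 1) 1 g = g ^ (r - 1) * exp (- g) / fact (r - 1)"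
    using True by (simp add: erlang_density_def)
  have 3: "erlang_density (A - 1) c g = c ^ A * (g ^ (r - 1) * g ^ (\<Sum>l\<in>I. n l)) * (exp (- g) * exp (- g * (\<Sum>l\<in>I. s l))) / fact (A - 1)"
  proof -
    have "g ^ (A - 1) = g ^ (r - 1) * g ^ (\<Sum>l\<in>I. n l)"
      using assms(2) by (simp add: power_add[symmetric] A_def)
    moreover have "exp (- c * g) = exp (- g) * exp (- g * (\<Sum>l\<in>I. s l))"
      by (simp add: exp_add[symmetric] c_def algebra_simps)
    ultimately show ?thesis
      using True A(2) unfolding erlang_density_def by simp
  qed
  have 4: "inverted_dirichlet_density I n r s
      = fact (A - 1) / (fact (r - 1) * (\<Prod>l\<in>I. fact (n l - 1))) * ((\<Prod>l\<in>I. s l ^ (n l - 1)) / c ^ A)"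
  proof -
    have "(\<Prod>l\<in>I. Gamma (real (n l))) = (\<Prod>l\<in>I. fact (n l - 1))"
      by (intro prod.cong refl Gamma_real_of_nat n)
    then show ?thesis
      using True A assms(2)
      by (simp add: inverted_dirichlet_density_def A_def[symmetric] c_def[symmetric] Gamma_real_of_nat
          del: of_nat_add)
  qed
  show ?thesis
    unfolding A_def[symmetric] c_def[symmetric] 1 2 3 4 using c by simp
next
  case False
  \<comment> \<open>Outside the support both sides vanish. If some \<open>s l\<close> is negative,
    the rate on the right may be nonpositive, but the inverted Dirichlet density is then 0.\<close>
  show ?thesis
  proof (cases "0 \<le> g")
    case True
    with False obtain l where l: "l \<in> I" "s l < 0" by auto
    then have "(\<Prod>l\<in>I. erlang_density (n l - 1) g (s l)) = 0"
      using assms(1) by (intro prod_zero) (auto simp: erlang_density_def)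
    moreover have "inverted_dirichlet_density I n r s = 0"
      using l by (force simp: inverted_dirichlet_density_def)
    ultimately show ?thesis by simp
  next
    case False
    then show ?thesis by (simp add: erlang_density_def)
  qed
qed

lemma inverted_dirichlet_density_nonneg: "0 \<le> inverted_dirichlet_density I n r s"
proof -
  have "0 \<le> Gamma (real k)" for k
    by (cases "k = 0") (auto intro!: less_imp_le[OF Gamma_real_pos])
  then show ?thesis
    by (auto simp: inverted_dirichlet_density_def simp del: of_nat_add of_nat_sum
        intro!: mult_nonneg_nonneg divide_nonneg_nonneg prod_nonneg add_nonneg_nonneg sum_nonneg zero_le_power)
qed

lemma borel_measurable_inverted_dirichlet_density [measurable]:
  assumes "finite I"
  shows "inverted_dirichlet_density I n r \<in> borel_measurable (Pi\<^sub>M I (\<lambda>_. lborel))"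
proof -
  have [measurable]: "(\<lambda>s. s l) \<in> borel_measurable (Pi\<^sub>M I (\<lambda>_. lborel))" if "l \<in> I" for l
    using measurable_component_singleton[OF that, of "\<lambda>_. lborel"] by simp
  have "{s \<in> space (Pi\<^sub>M I (\<lambda>_. lborel)). \<forall>k\<in>I. (0::real) \<le> s k} \<in> sets (Pi\<^sub>M I (\<lambda>_. lborel))"
  proof (intro sets.sets_Collect_finite_All assms)
    fix k assume [simp]: "k \<in> I"
    show "{s \<in> space (Pi\<^sub>M I (\<lambda>_. lborel)). (0::real) \<le> s k} \<in> sets (Pi\<^sub>M I (\<lambda>_. lborel :: real measure))"
      by measurable
  qed
  then show ?thesis
    unfolding inverted_dirichlet_density_def[abs_def]
    by (intro measurable_If borel_measurable_times borel_measurable_divide borel_measurable_prod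
        borel_measurable_power borel_measurable_add borel_measurable_sum borel_measurable_const) auto
qed

text \<open>Instead of evaluating a beta integral, an auxiliary gamma variable \<open>g\<close> is
  inserted. Given \<open>g\<close>, the coordinates are independent Erlang variables of rate
  \<open>g\<close>, so the last one integrates to 1. For \<open>m = 2\<close> the density over the
  empty index set is the constant 1.\<close>

lemma inverted_dirichlet_marginal_density_eq:
  assumes "2 \<le> m" and n: "\<And>k. k \<in> {1..m} \<Longrightarrow> 1 \<le> n k"
  shows "inverted_dirichlet_marginal_density m n s = inverted_dirichlet_density {2..<m} n (n 1) s"
proof (cases "\<forall>k\<in>{2..<m}. 0 \<le> s k")
  case True
  let ?f = "\<lambda>t. inverted_dirichlet_density {2..m} n (n 1) (s(m := t))"
  define c where "c = 1 + (\<Sum>l\<in>{2..<m}. s l)"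
  have c: "0 < c" using True by (auto simp: c_def intro!: add_pos_nonneg sum_nonneg)
  have ins: "{2..m} = insert m {2..<m}" using assms by auto
  let ?A = "n 1 + (\<Sum>l\<in>{2..m}. n l)"
  let ?A' = "n 1 + (\<Sum>l\<in>{2..<m}. n l)"
  have n1: "1 \<le> n 1" and nm: "1 \<le> n m" using n assms(1) by auto
  have f0: "0 \<le> ?f t" for t by (rule inverted_dirichlet_density_nonneg)
  have ID0: "0 \<le> inverted_dirichlet_density {2..<m} n (n 1) s" by (rule inverted_dirichlet_density_nonneg)
  have sum: "(\<Sum>l\<in>{2..m}. (s(m := t)) l) = t + (\<Sum>l\<in>{2..<m}. s l)" for t
    unfolding ins by (simp cong: sum.cong_simp)
  have meas: "?f \<in> borel_measurable borel"
  proof -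
    have "(\<Prod>k\<in>{2..m}. (s(m := t)) k ^ (n k - 1)) = t ^ (n m - 1) * (\<Prod>k\<in>{2..<m}. s k ^ (n k - 1))" for t
      unfolding ins by (simp cong: prod.cong_simp)
    moreover have "(\<forall>k\<in>{2..m}. 0 \<le> (s(m := t)) k) \<longleftrightarrow> 0 \<le> t" for t
      using True assms(1) unfolding ins by auto
    ultimately show ?thesis
      unfolding inverted_dirichlet_density_def sum by (simp only:) measurable
  qed
  have "(\<integral>\<^sup>+t. ennreal (?f t) \<partial>lborel)
      = (\<integral>\<^sup>+t. (\<integral>\<^sup>+g. ennreal (?f t * erlang_density (?A - 1) (t + c) g) \<partial>lborel) \<partial>lborel)"
  proof (rule nn_integral_cong)
    fix t :: real
    show "ennreal (?f t) = (\<integral>\<^sup>+g. ennreal (?f t * erlang_density (?A - 1) (t + c) g) \<partial>lborel)"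
    proof (cases "0 \<le> t")
      case True
      then show ?thesis
        using c f0[of t] by (simp add: ennreal_mult' nn_integral_cmult nn_integral_erlang_density_1)
    next
      case False
      have "?f t = 0" unfolding inverted_dirichlet_density_def using False assms(1) by auto
      then show ?thesis by simp
    qed
  qed
  \<comment> \<open>The factorisation of the joint density is read from right to left on
    \<open>{2..m}\<close> and from left to right on \<open>{2..<m}\<close>; the last coordinate
    splits off in between.\<close>
  also have "\<dots> = (\<integral>\<^sup>+t. (\<integral>\<^sup>+g. ennreal (inverted_dirichlet_density {2..<m} n (n 1) s * erlang_density (?A' - 1) c g)
        * ennreal (erlang_density (n m - 1) g t) \<partial>lborel) \<partial>lborel)"
  proof (intro nn_integral_cong)
    fix t g :: real
    have prod: "(\<Prod>l\<in>{2..m}. erlang_density (n l - 1) g ((s(m := t)) l))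
       = erlang_density (n m - 1) g t * (\<Prod>l\<in>{2..<m}. erlang_density (n l - 1) g (s l))"
      unfolding ins by (simp cong: prod.cong_simp)
    have "?f t * erlang_density (?A - 1) (t + c) g
       = erlang_density (n 1 - 1) 1 g * (\<Prod>l\<in>{2..m}. erlang_density (n l - 1) g ((s(m := t)) l))"
      using n n1 sum[of t] by (subst erlang_prod_eq_inverted_dirichlet) (auto simp: c_def add_ac)
    also have "\<dots> = inverted_dirichlet_density {2..<m} n (n 1) s * erlang_density (?A' - 1) c g
        * erlang_density (n m - 1) g t"
      unfolding prod c_def using n n1 by (subst erlang_prod_eq_inverted_dirichlet[symmetric]) auto
    finally have eq: "?f t * erlang_density (?A - 1) (t + c) g = \<dots>" .
    show "ennreal (?f t * erlang_density (?A - 1) (t + c) g)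
      = ennreal (inverted_dirichlet_density {2..<m} n (n 1) s * erlang_density (?A' - 1) c g)
        * ennreal (erlang_density (n m - 1) g t)"
      unfolding eq using ID0 c by (intro ennreal_mult') (auto intro!: mult_nonneg_nonneg)
  qed
  also have "\<dots> = (\<integral>\<^sup>+g. (\<integral>\<^sup>+t. ennreal (inverted_dirichlet_density {2..<m} n (n 1) s * erlang_density (?A' - 1) c g)
        * ennreal (erlang_density (n m - 1) g t) \<partial>lborel) \<partial>lborel)"
    by (rule lborel_pair.Fubini') (simp add: erlang_density_def split_beta')
  also have "\<dots> = (\<integral>\<^sup>+g. ennreal (inverted_dirichlet_density {2..<m} n (n 1) s * erlang_density (?A' - 1) c g) \<partial>lborel)"
  proof (rule nn_integral_cong_AE)
    show "AE g in lborel. (\<integral>\<^sup>+t. ennreal (inverted_dirichlet_density {2..<m} n (n 1) s * erlang_density (?A' - 1) c g)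
        * ennreal (erlang_density (n m - 1) g t) \<partial>lborel)
      = ennreal (inverted_dirichlet_density {2..<m} n (n 1) s * erlang_density (?A' - 1) c g)"
      using AE_lborel_singleton[of "0::real"]
    proof eventually_elim
      case (elim g)
      show ?case
      proof (cases "0 < g")
        case True
        then show ?thesis by (simp add: nn_integral_cmult nn_integral_erlang_density_1)
      next
        case False
        with elim have "erlang_density (?A' - 1) c g = 0" by (simp add: erlang_density_def)
        then show ?thesis by simp
      qed
    qed
  qed
  also have "\<dots> = ennreal (inverted_dirichlet_density {2..<m} n (n 1) s)"
    using c ID0 by (simp add: ennreal_mult' nn_integral_cmult nn_integral_erlang_density_1)
  finally show ?thesis
    unfolding inverted_dirichlet_marginal_density_def
    using f0 ID0 meas by (subst integral_eq_nn_integral) auto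
next
  case False
  then have "inverted_dirichlet_density {2..m} n (n 1) (s(m := t)) = 0" for t
    by (auto simp: inverted_dirichlet_density_def)
  then show ?thesis
    using False by (auto simp: inverted_dirichlet_marginal_density_def inverted_dirichlet_density_def)
qed

section \<open>Gamma tails and the limit in the last parameter\<close>

lemma set_integral_gamma_density_atLeast:
  assumes "0 < a"
  shows "(LBINT t:{x..}. gamma_density a t) = 1 - cdf (gamma_distribution a) x"
proof -
  interpret real_distribution "gamma_distribution a"
    by (rule real_distribution_gamma_distribution[OF assms])
  have "(LBINT t:{x..}. gamma_density a t) = integral\<^sup>L (gamma_distribution a) (indicator {x..})"
    using assms by (subst integral_gamma_distribution)
      (auto simp: set_lebesgue_integral_def mult.commute)
  also have "\<dots> = measure (gamma_distribution a) {x..}" by simp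
  also have "\<dots> = measure (gamma_distribution a) ({x} \<union> {x<..})"
    by (rule arg_cong) auto
  also have "\<dots> = measure (gamma_distribution a) {x} + measure (gamma_distribution a) {x<..}"
    by (rule finite_measure_Union) auto
  also have "\<dots> = measure (gamma_distribution a) (space (gamma_distribution a) - {..x})"
    by (simp add: measure_gamma_distribution_singleton Compl_eq_Diff_UNIV[symmetric])
  also have "\<dots> = 1 - cdf (gamma_distribution a) x"
    unfolding cdf_def by (rule prob_compl) simp
  finally show ?thesis .
qed

lemma nn_integral_erlang_density_greaterThan:
  assumes "1 \<le> n" "0 < c"
  shows "(\<integral>\<^sup>+g. ennreal (erlang_density (n - 1) c g) * indicator {r<..} g \<partial>lborel)
    = ennreal (1 - cdf (gamma_distribution (real n)) (c * r))"
proof -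
  let ?D = "density lborel (\<lambda>g. ennreal (erlang_density (n - 1) c g))"
  interpret prob_space ?D using assms by (intro prob_space_erlang_density) auto
  have "(\<integral>\<^sup>+g. ennreal (erlang_density (n - 1) c g) * indicator {r<..} g \<partial>lborel) = emeasure ?D {r<..}"
    by (simp add: emeasure_density)
  also have "\<dots> = ennreal (measure ?D (space ?D - {..r}))"
    unfolding emeasure_eq_measure
    by (rule arg_cong[where f="\<lambda>S. ennreal (measure ?D S)"]) auto
  also have "measure ?D (space ?D - {..r}) = 1 - measure ?D {..r}"
    by (rule prob_compl) simp
  also have "measure ?D {..r} = erlang_CDF (n - 1) c r"
    using assms by (simp add: measure_def emeasure_erlang_density)
  also have "\<dots> = cdf (gamma_distribution (real n)) (c * r)"
    using assms erlang_CDF_transform[of c "n - 1" r]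
    by (simp add: gamma_distribution_of_nat cdf_def measure_def emeasure_erlang_density)
  finally show ?thesis .
qed

text \<open>Writing each distribution function as an integral over \<open>s l \<le> q l\<close> and
  exchanging the integrals leaves, for fixed \<open>s\<close>, the inverted Dirichlet density times
  the tail beyond \<open>b\<close> of a gamma variable with rate
  \<open>1 + (\<Sum>l\<in>J. s l)\<close>. Rescaling to rate 1 moves this factor into the argument
  of the tail.\<close>

proposition integral_prod_cdf_eq_inverted_dirichlet:
  fixes n :: "nat \<Rightarrow> nat" and b :: real and q :: "nat \<Rightarrow> real"
  assumes J: "finite J" and r: "1 \<le> r" and n: "\<And>l. l \<in> J \<Longrightarrow> 1 \<le> n l"
  defines "A \<equiv> r + (\<Sum>l\<in>J. n l)"
  shows "(\<integral>g. (\<Prod>l\<in>J. cdf (gamma_distribution (real (n l))) (q l * g)) * indicator {b<..} g \<partial>gamma_distribution (real r))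
    = (LINT s:(\<Pi>\<^sub>E l\<in>J. {0..q l})|Pi\<^sub>M J (\<lambda>_. lborel).
        (1 - cdf (gamma_distribution (real A)) (b * (1 + (\<Sum>l\<in>J. s l)))) * inverted_dirichlet_density J n r s)"
proof -
  let ?B = "\<Pi>\<^sub>E l\<in>J. {0..q l}"
  let ?M = "Pi\<^sub>M J (\<lambda>_. lborel :: real measure)"
  let ?e = "\<lambda>l g s. ennreal (erlang_density (n l - 1) g s) * indicator {..q l} s"
  interpret P: product_sigma_finite "\<lambda>_::nat. lborel :: real measure" ..
  interpret PJ: sigma_finite_measure ?M by (rule P.sigma_finite[OF J])
  interpret Q: pair_sigma_finite ?M "lborel :: real measure" ..
  have pos: "0 < real (n l)" if "l \<in> J" for l using n[OF that] by simp
  have A: "1 \<le> A" using r by (simp add: A_def)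
  have comp [measurable]: "(\<lambda>s. s l) \<in> borel_measurable ?M" if "l \<in> J" for l
    using measurable_component_singleton[OF that, of "\<lambda>_. lborel"] by simp
  have ID_meas [measurable]: "inverted_dirichlet_density J n r \<in> borel_measurable ?M"
    by (rule borel_measurable_inverted_dirichlet_density[OF J])
  have cdf_meas [measurable]: "cdf (gamma_distribution (real A)) \<in> borel_measurable borel"
    using A by (intro borel_measurable_cdf_gamma_distribution) simp
  have sum_meas [measurable]: "(\<lambda>s. \<Sum>l\<in>J. s l) \<in> borel_measurable ?M"
    by (intro borel_measurable_sum comp)
  have B_meas [measurable]: "?B \<in> sets ?M"
    using J by (intro sets_PiM_I_finite) auto
  have "(\<integral>\<^sup>+g. ennreal ((\<Prod>l\<in>J. cdf (gamma_distribution (real (n l))) (q l * g)) * indicator {b<..} g) \<partial>gamma_distribution (real r))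
     = (\<integral>\<^sup>+g. ennreal (erlang_density (r - 1) 1 g) * ((\<Prod>l\<in>J. ennreal (cdf (gamma_distribution (real (n l))) (q l * g))) * indicator {b<..} g) \<partial>lborel)"
  proof -
    have meas: "(\<lambda>g. ennreal ((\<Prod>l\<in>J. cdf (gamma_distribution (real (n l))) (q l * g)) * indicator {b<..} g)) \<in> borel_measurable lborel"
      by (intro measurable_compose[OF _ measurable_ennreal] borel_measurable_times)
         (auto intro: borel_measurable_prod_cdf_gamma_distribution pos)
    have integrand: "ennreal ((\<Prod>l\<in>J. cdf (gamma_distribution (real (n l))) (q l * g)) * indicator {b<..} g)
      = (\<Prod>l\<in>J. ennreal (cdf (gamma_distribution (real (n l))) (q l * g))) * indicator {b<..} g" for g
      by (simp add: prod_ennreal cdf_gamma_distribution_nonneg prod_nonneg ennreal_mult' ennreal_indicator)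
    show ?thesis
      unfolding gamma_distribution_of_nat[OF r]
      by (subst nn_integral_density[OF _ meas]) (simp_all only: integrand, simp)
  qed
  also have "\<dots> = (\<integral>\<^sup>+g. (\<integral>\<^sup>+s. ennreal (erlang_density (r - 1) 1 g) * ((\<Prod>l\<in>J. ?e l g (s l)) * indicator {b<..} g) \<partial>?M) \<partial>lborel)"
  proof (rule nn_integral_cong_AE)
    \<comment> \<open>The Erlang densities of rate \<open>g\<close> represent the distribution
      functions for positive \<open>g\<close>; for negative \<open>g\<close> the leading density is
      0.\<close>
    have "ennreal (erlang_density (r - 1) 1 g) * ((\<Prod>l\<in>J. ennreal (cdf (gamma_distribution (real (n l))) (q l * g))) * indicator {b<..} g)
       = (\<integral>\<^sup>+s. ennreal (erlang_density (r - 1) 1 g) * ((\<Prod>l\<in>J. ?e l g (s l)) * indicator {b<..} g) \<partial>?M)"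
      if "g \<noteq> 0" for g
    proof (cases "0 < g")
      case True
      have "(\<Prod>l\<in>J. ennreal (cdf (gamma_distribution (real (n l))) (q l * g))) = (\<Prod>l\<in>J. \<integral>\<^sup>+s. ?e l g s \<partial>lborel)"
        using n True by (intro prod.cong refl cdf_gamma_distribution_eq_nn_integral)
      also have "\<dots> = (\<integral>\<^sup>+s. (\<Prod>l\<in>J. ?e l g (s l)) \<partial>?M)"
        using J by (intro P.product_nn_integral_prod[symmetric]) auto
      finally show ?thesis
        by (subst nn_integral_cmult; (subst nn_integral_multc)?) auto
    next
      case False
      with that show ?thesis by (simp add: erlang_density_def)
    qed
    then show "AE g in lborel. ennreal (erlang_density (r - 1) 1 g) * ((\<Prod>l\<in>J. ennreal (cdf (gamma_distribution (real (n l))) (q l * g))) * indicator {b<..} g)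
       = (\<integral>\<^sup>+s. ennreal (erlang_density (r - 1) 1 g) * ((\<Prod>l\<in>J. ?e l g (s l)) * indicator {b<..} g) \<partial>?M)"
      by (rule eventually_mono[OF AE_lborel_singleton[of "0::real"]])
  qed
  also have "\<dots> = (\<integral>\<^sup>+s. (\<integral>\<^sup>+g. ennreal (erlang_density (r - 1) 1 g) * ((\<Prod>l\<in>J. ?e l g (s l)) * indicator {b<..} g) \<partial>lborel) \<partial>?M)"
    by (rule Q.Fubini') (simp add: erlang_density_def split_beta')
  also have "\<dots> = (\<integral>\<^sup>+s. ennreal (indicator ?B s * ((1 - cdf (gamma_distribution (real A)) (b * (1 + (\<Sum>l\<in>J. s l)))) * inverted_dirichlet_density J n r s)) \<partial>?M)"
  proof (rule nn_integral_cong)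
    fix s assume s: "s \<in> space ?M"
    have e: "(\<Prod>l\<in>J. ?e l g (s l)) = ennreal (\<Prod>l\<in>J. erlang_density (n l - 1) g (s l)) * (\<Prod>l\<in>J. indicator {..q l} (s l))" if "0 \<le> g" for g
      using that by (simp add: prod.distrib prod_ennreal)
    have *: "ennreal (erlang_density (r - 1) 1 g) * ((\<Prod>l\<in>J. ?e l g (s l)) * indicator {b<..} g)
      = ennreal (inverted_dirichlet_density J n r s) * (\<Prod>l\<in>J. indicator {..q l} (s l))
         * (ennreal (erlang_density (A - 1) (1 + (\<Sum>l\<in>J. s l)) g) * indicator {b<..} g)" for g
    proof (cases "0 \<le> g")
      case True
      have "ennreal (erlang_density (r - 1) 1 g) * ennreal (\<Prod>l\<in>J. erlang_density (n l - 1) g (s l))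
         = ennreal (inverted_dirichlet_density J n r s * erlang_density (A - 1) (1 + (\<Sum>l\<in>J. s l)) g)"
        unfolding A_def using J r n
        by (subst erlang_prod_eq_inverted_dirichlet[symmetric]) (auto simp: ennreal_mult')
      also have "\<dots> = ennreal (inverted_dirichlet_density J n r s) * ennreal (erlang_density (A - 1) (1 + (\<Sum>l\<in>J. s l)) g)"
        by (intro ennreal_mult' inverted_dirichlet_density_nonneg)
      finally show ?thesis
        unfolding e[OF True] by (simp add: mult.assoc[symmetric]) (simp add: ac_simps)
    next
      case False
      then show ?thesis by (simp add: erlang_density_def)
    qed
    show "(\<integral>\<^sup>+g. ennreal (erlang_density (r - 1) 1 g) * ((\<Prod>l\<in>J. ?e l g (s l)) * indicator {b<..} g) \<partial>lborel)
      = ennreal (indicator ?B s * ((1 - cdf (gamma_distribution (real A)) (b * (1 + (\<Sum>l\<in>J. s l)))) * inverted_dirichlet_density J n r s))"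
    proof (cases "s \<in> ?B")
      case True
      then have c: "0 < 1 + (\<Sum>l\<in>J. s l)" by (auto simp: PiE_iff intro!: add_pos_nonneg sum_nonneg)
      have "(\<Prod>l\<in>J. indicator {..q l} (s l)) = (1 :: ennreal)"
        using True by (intro prod.neutral) (auto simp: PiE_iff)
      then show ?thesis
        unfolding * using True nn_integral_erlang_density_greaterThan[OF A c, of b]
          inverted_dirichlet_density_nonneg[of J n r s]
        by (simp add: nn_integral_cmult mult.commute[of b]
            ennreal_mult' mult.commute[of _ "inverted_dirichlet_density J n r s"])
    next
      case False
      \<comment> \<open>Off the box some coordinate is negative, where the inverted Dirichlet
        density is 0, or exceeds \<open>q l\<close>, where an indicator is 0.\<close>
      then obtain l where l: "l \<in> J" "s l < 0 \<or> q l < s l"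
        using s by (force simp: space_PiM PiE_iff)
      have z: "ennreal (inverted_dirichlet_density J n r s) * (\<Prod>l\<in>J. indicator {..q l} (s l)) = 0"
      proof (cases "s l < 0")
        case True
        with l show ?thesis by (force simp: inverted_dirichlet_density_def)
      next
        case False
        with l J have "(\<Prod>l\<in>J. indicator {..q l} (s l)) = (0 :: ennreal)"
          by (intro prod_zero) (auto intro!: bexI[of _ l])
        then show ?thesis by simp
      qed
      show ?thesis unfolding * z using False by simp
    qed
  qed
  finally have eq: "(\<integral>\<^sup>+g. ennreal ((\<Prod>l\<in>J. cdf (gamma_distribution (real (n l))) (q l * g)) * indicator {b<..} g) \<partial>gamma_distribution (real r))
    = \<dots>" .
  have lhs_meas: "(\<lambda>g. (\<Prod>l\<in>J. cdf (gamma_distribution (real (n l))) (q l * g)) * indicator {b<..} g)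
      \<in> borel_measurable (gamma_distribution (real r))"
    unfolding measurable_cong_sets[OF sets_gamma_distribution refl]
    by (intro borel_measurable_times borel_measurable_prod_cdf_gamma_distribution pos) auto
  have "cdf (gamma_distribution (real A)) x \<le> 1" for x
    using A by (intro cdf_gamma_distribution_le_1) simp
  then show ?thesis
    unfolding set_lebesgue_integral_def
    by (subst (1 2) integral_eq_nn_integral)
       (auto simp: eq cdf_gamma_distribution_nonneg inverted_dirichlet_density_nonneg
         intro!: prod_nonneg mult_nonneg_nonneg lhs_meas)
qed

text \<open>The mixing law Gamma(n 1, 1) stays fixed, so dominated convergence with the constant 1
  applies, and only the last distribution function varies. For \<open>m = 2\<close> the outer
  integral runs over the one-point space of functions on the empty index set.\<close>

theorem LIMSEQ_tau1_last:
  fixes n :: "nat \<Rightarrow> nat"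
  assumes "2 \<le> m" and n: "\<And>k. k \<in> {1..m} \<Longrightarrow> 1 \<le> n k"
  shows "(\<lambda>N. tau1 m (n(m := N)))
    \<longlonglongrightarrow> (LINT s:(\<Pi>\<^sub>E k\<in>{2..<m}. {0..real (n k) / real (n 1)})
              |Pi\<^sub>M {2..<m} (\<lambda>_. lborel).
           (LBINT t:{real (n 1) * (1 + (\<Sum>k=2..<m. s k))..}.
              gamma_density (real (\<Sum>k=1..<m. n k)) t)
           * inverted_dirichlet_marginal_density m n s)"
proof -
  define r where "r = n 1"
  have r: "1 \<le> r" using n[of 1] assms(1) by (simp add: r_def)
  let ?G = "gamma_distribution (real r)"
  let ?p = "\<lambda>g. \<Prod>l=2..<m. cdf (gamma_distribution (real (n l))) (real (n l) / real r * g)"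
  let ?u = "\<lambda>N g. ?p g * cdf (gamma_distribution (real N)) (real N / real r * g)"
  have pos: "0 < real (n l)" if "l \<in> {2..<m}" for l using n[of l] that by simp
  have ins: "{2..m} = insert m {2..<m}" and ins': "{1..<m} = insert 1 {2..<m}"
    using assms by auto
  interpret G: prob_space ?G using r by (intro prob_space_gamma_distribution) simp
  have p_meas [measurable]: "?p \<in> borel_measurable borel"
    using pos by (rule borel_measurable_prod_cdf_gamma_distribution)
  have tau1_eq: "tau1 m (n(m := N)) = (\<integral>g. ?u N g \<partial>?G)" if "1 \<le> N" for N
  proof -
    have "tau1 m (n(m := N)) = tau1_mixture m (\<lambda>k. real ((n(m := N)) k))"
      using n that by (intro tau1_eq_mixture[OF assms(1)]) auto
    also have "\<dots> = (\<integral>g. ?u N g \<partial>?G)"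
      unfolding tau1_mixture_def ins using assms(1)
      by (auto simp: r_def mult.commute intro!: Bochner_Integration.integral_cong prod.cong arg_cong2[where f="(*)"])
    finally show ?thesis .
  qed
  \<comment> \<open>The shift to \<open>Suc N\<close> keeps the last shape parameter positive for
    every index.\<close>
  have "(\<lambda>N. \<integral>g. ?u (Suc N) g \<partial>?G) \<longlonglongrightarrow> (\<integral>g. ?p g * indicator {real r<..} g \<partial>?G)"
  proof (rule integral_dominated_convergence[where w = "\<lambda>_. 1"])
    show "(\<lambda>g. ?u (Suc N) g) \<in> borel_measurable ?G" for N
      unfolding measurable_cong_sets[OF sets_gamma_distribution refl]
      by (intro borel_measurable_times p_meas measurable_compose[OF _ borel_measurable_cdf_gamma_distribution]) simp_all
    show "(\<lambda>g. ?p g * indicator {real r<..} g) \<in> borel_measurable ?G"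
      unfolding measurable_cong_sets[OF sets_gamma_distribution refl]
      by (intro borel_measurable_times p_meas) simp
    show "AE g in ?G. (\<lambda>N. ?u (Suc N) g) \<longlonglongrightarrow> ?p g * indicator {real r<..} g"
    proof (rule AE_gamma_distribution)
      \<comment> \<open>The law of large numbers decides every \<open>g\<close> except the threshold
        \<open>real r\<close>, a null set.\<close>
      have "(\<lambda>N. ?u (Suc N) g) \<longlonglongrightarrow> ?p g * indicator {real r<..} g" if "g \<noteq> real r" for g
      proof (intro tendsto_mult tendsto_const)
        have "(\<lambda>N. cdf (gamma_distribution (real N)) (real N * (g / real r))) \<longlonglongrightarrow> indicator {1<..} (g / real r)"
          using that r by (intro cdf_gamma_distribution_LLN) simp
        also have "indicator {1<..} (g / real r) = (indicator {real r<..} g :: real)"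
          using r by (simp add: indicator_def less_divide_eq)
        finally have "(\<lambda>N. cdf (gamma_distribution (real N)) (real N / real r * g)) \<longlonglongrightarrow> indicator {real r<..} g"
          by simp
        then show "(\<lambda>N. cdf (gamma_distribution (real (Suc N))) (real (Suc N) / real r * g)) \<longlonglongrightarrow> indicator {real r<..} g"
          by (rule LIMSEQ_Suc)
      qed
      then show "AE g in lborel. (\<lambda>N. ?u (Suc N) g) \<longlonglongrightarrow> ?p g * indicator {real r<..} g"
        by (rule eventually_mono[OF AE_lborel_singleton[of "real r"]])
    qed
    have "\<bar>?u (Suc N) g\<bar> \<le> 1 * 1" for N g
      unfolding abs_mult using pos
      by (intro mult_mono prod_cdf_gamma_distribution_le_1)
         (auto simp: cdf_gamma_distribution_nonneg cdf_gamma_distribution_le_1)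
    then show "AE g in ?G. norm (?u (Suc N) g) \<le> 1" for N by simp
  qed auto
  then have "(\<lambda>N. tau1 m (n(m := Suc N))) \<longlonglongrightarrow> (\<integral>g. ?p g * indicator {real r<..} g \<partial>?G)"
    by (simp only: tau1_eq le_add1 plus_1_eq_Suc[symmetric])
  then have "(\<lambda>N. tau1 m (n(m := N))) \<longlonglongrightarrow> (\<integral>g. ?p g * indicator {real r<..} g \<partial>?G)"
    by (rule LIMSEQ_imp_Suc)
  also have "(\<integral>g. ?p g * indicator {real r<..} g \<partial>?G)
    = (LINT s:(\<Pi>\<^sub>E k\<in>{2..<m}. {0..real (n k) / real r})|Pi\<^sub>M {2..<m} (\<lambda>_. lborel).
        (1 - cdf (gamma_distribution (real (r + (\<Sum>l=2..<m. n l)))) (real r * (1 + (\<Sum>l=2..<m. s l))))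
        * inverted_dirichlet_density {2..<m} n r s)"
    using r n by (intro integral_prod_cdf_eq_inverted_dirichlet) auto
  also have "r + (\<Sum>l=2..<m. n l) = (\<Sum>k=1..<m. n k)"
    unfolding ins' by (simp add: r_def)
  finally have lim: "(\<lambda>N. tau1 m (n(m := N)))
    \<longlonglongrightarrow> (LINT s:(\<Pi>\<^sub>E k\<in>{2..<m}. {0..real (n k) / real r})|Pi\<^sub>M {2..<m} (\<lambda>_. lborel).
        (1 - cdf (gamma_distribution (real (\<Sum>k=1..<m. n k))) (real r * (1 + (\<Sum>l=2..<m. s l))))
        * inverted_dirichlet_density {2..<m} n r s)" .
  have "0 < real (\<Sum>k=1..<m. n k)"
    unfolding ins' using r by (simp add: r_def del: of_nat_sum of_nat_add)
  note tail = set_integral_gamma_density_atLeast[OF this]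
  have "inverted_dirichlet_marginal_density m n s = inverted_dirichlet_density {2..<m} n r s" for s
    unfolding r_def using n by (rule inverted_dirichlet_marginal_density_eq[OF assms(1)])
  with lim show ?thesis
    unfolding tail by (simp only: r_def)
qed

theorem theorem34:
  fixes m :: nat
  assumes "2 \<le> m"
  shows "(\<forall>n::nat \<Rightarrow> nat. (\<forall>k\<in>{2..m}. 1 \<le> n k) \<longrightarrow>
            (\<lambda>N. tau1 m (n(1 := N)))
              \<longlonglongrightarrow> (\<Prod>k=2..m. measure (gamma_distribution (real (n k))) {..real (n k)}))
       \<and> (\<forall>n::nat \<Rightarrow> nat. (\<forall>k\<in>{1..m}. 1 \<le> n k) \<longrightarrow>
            (\<lambda>N. tau1 m (n(m := N)))
              \<longlonglongrightarrow> (LINT s:(\<Pi>\<^sub>E k\<in>{2..<m}. {0..real (n k) / real (n 1)})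
                        |Pi\<^sub>M {2..<m} (\<lambda>_. lborel).
                     (LBINT t:{real (n 1) * (1 + (\<Sum>k=2..<m. s k))..}.
                        gamma_density (real (\<Sum>k=1..<m. n k)) t)
                     * inverted_dirichlet_marginal_density m n s))
       \<and> (\<forall>\<alpha>::nat \<Rightarrow> real. (\<forall>k\<in>{1..m}. 0 < \<alpha> k) \<longrightarrow>
            (\<lambda>n. tau1_real m (\<lambda>j. \<alpha> j * real n))
              \<longlonglongrightarrow> (LBINT z. (\<Prod>k=2..m. cdf std_normal_distribution (sqrt (\<alpha> k / \<alpha> 1) * z))
                              * std_normal_density z))"
proof (intro conjI allI impI)
  fix n :: "nat \<Rightarrow> nat"
  assume "\<forall>k\<in>{2..m}. 1 \<le> n k"
  then show "(\<lambda>N. tau1 m (n(1 := N)))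
      \<longlonglongrightarrow> (\<Prod>k=2..m. measure (gamma_distribution (real (n k))) {..real (n k)})"
    using LIMSEQ_tau1_first[OF assms, of n] by (simp only: cdf_def Ball_def)
next
  fix n :: "nat \<Rightarrow> nat"
  assume "\<forall>k\<in>{1..m}. 1 \<le> n k"
  then show "(\<lambda>N. tau1 m (n(m := N)))
      \<longlonglongrightarrow> (LINT s:(\<Pi>\<^sub>E k\<in>{2..<m}. {0..real (n k) / real (n 1)})
                |Pi\<^sub>M {2..<m} (\<lambda>_. lborel).
             (LBINT t:{real (n 1) * (1 + (\<Sum>k=2..<m. s k))..}.
                gamma_density (real (\<Sum>k=1..<m. n k)) t)
             * inverted_dirichlet_marginal_density m n s)"
    by (intro LIMSEQ_tau1_last[OF assms]) blast
next
  fix \<alpha> :: "nat \<Rightarrow> real"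
  assume "\<forall>k\<in>{1..m}. 0 < \<alpha> k"
  then show "(\<lambda>n. tau1_real m (\<lambda>j. \<alpha> j * real n))
      \<longlonglongrightarrow> (LBINT z. (\<Prod>k=2..m. cdf std_normal_distribution (sqrt (\<alpha> k / \<alpha> 1) * z))
                      * std_normal_density z)"
    by (intro LIMSEQ_tau1_real[OF assms]) blast
qed

end
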